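(* For $n\ge1$ let $\mathcal{S}_n=\{A+A : A\subseteq \mathbb{F}_2^n\}$, where $A+A=\{a+b: a,b\in A\}$, and let $$\mathcal{H}_n=\{S\subseteq \mathbb{F}_2^n : \exists\, v\in\mathbb{F}_2^n \text{ with } v^\perp\subseteq S\}.$$ Then $|\mathcal{S}_n\,\Delta\,\mathcal{H}_n| = o(|\mathcal{S}_n|)$ as $n\to\infty$.
   Context: $v^\perp=\{x\in\mathbb{F}_2^n : \langle x,v\rangle=0\}$ where $\langle x,v\rangle=\sum_i x_iv_i\in\mathbb{F}_2$. $\Delta$ denotes symmetric difference of families of sets. In $A+A$ the sums $a+a$ are included. *)

theory Defs
  imports
    "HOL-Library.Z2"
    "HOL-Library.Function_Algebras"
    "HOL-Library.Set_Algebras"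
    "HOL-Library.Landau_Symbols"
begin

text \<open>Since the dimension \<open>n\<close> varies, $F_2^n$ is modelled by the functions
  \<^typ>\<open>nat \<Rightarrow> bit\<close> that vanish at all indices \<open>\<ge> n\<close>. Vector addition is the pointwise
  addition of functions, and the sum of two sets is the Minkowski sum of
  \<^theory>\<open>HOL-Library.Set_Algebras\<close>.\<close>

definition F2 :: "nat \<Rightarrow> (nat \<Rightarrow> bit) set" where
  "F2 n = {x. \<forall>i\<ge>n. x i = 0}"

definition dot :: "nat \<Rightarrow> (nat \<Rightarrow> bit) \<Rightarrow> (nat \<Rightarrow> bit) \<Rightarrow> bit" where
  "dot n x v = (\<Sum>i<n. x i * v i)"

definition perp :: "nat \<Rightarrow> (nat \<Rightarrow> bit) \<Rightarrow> (nat \<Rightarrow> bit) set" where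
  "perp n v = {x \<in> F2 n. dot n x v = 0}"

definition sumset_family :: "nat \<Rightarrow> (nat \<Rightarrow> bit) set set" where
  "sumset_family n = {A + A | A. A \<subseteq> F2 n}"

definition perp_superset_family :: "nat \<Rightarrow> (nat \<Rightarrow> bit) set set" where
  "perp_superset_family n = {S. S \<subseteq> F2 n \<and> (\<exists>v\<in>F2 n. perp n v \<subseteq> S)}"

end

theory Submission
  imports Defs "HOL-Library.FuncSet" "HOL-Real_Asymp.Real_Asymp"
begin

text \<open>Write \<open>N = 2\<^sup>n\<close>. Both differences of the two families have size at most
  \<open>2\<^bsup>(1/2 - c) N\<^esup>\<close>, whereas at least \<open>2\<^bsup>N/2\<^esup>\<close> sets contain a hyperplane.

  If \<open>S\<close> contains the hyperplane \<open>H\<close> and \<open>P = S - H\<close> satisfies \<open>P + P = H\<close>, then \<open>S = A + A\<close> for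
  \<open>A = {w} \<union> (P + w)\<close> with any \<open>w \<notin> H\<close>. Otherwise \<open>P\<close> meets each pair \<open>{p, p + x}\<close> at most
  once for some \<open>x\<close>, which leaves \<open>3\<^bsup>N/4\<^esup>\<close> choices for each \<open>x\<close>.

  For a sumset \<open>A + A\<close> containing no hyperplane, a random sparse \<open>B \<subseteq> A\<close> has all popular sums of
  \<open>A\<close> in \<open>B + B\<close>, so \<open>A\<close> spans few edges in the Cayley graph of \<open>D = - (B + B)\<close>, and there are few
  choices for \<open>D\<close>. If \<open>D\<close> has density less than \<open>1/2 - \<gamma>\<close>, count the sets \<open>A + A\<close> by their
  complements, which lie in \<open>D\<close>. If \<open>D\<close> is almost disjoint from a hyperplane, then
  \<open>A\<close> is almost contained in a coset of it and is counted as in the first part. In the remaining case the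
  Fourier coefficients of \<open>D\<close> are far from their smallest possible value, Hoffman's bound limits sets
  spanning few edges to density \<open>1/2 - c\<close>, and a graph container argument counts the sets \<open>A\<close>.\<close>

subsection \<open>The space\<close>

lemma F2_add_self [simp]: "x + x = 0" for x :: "nat \<Rightarrow> bit"
  by (rule ext) simp

lemma F2_add_add_cancel [simp]: "x + (x + y) = y" "x + y + y = x" for x y :: "nat \<Rightarrow> bit"
  by (rule ext, simp)+

lemma F2_add_eq_iff: "x + y = z \<longleftrightarrow> x = z + y" for x y z :: "nat \<Rightarrow> bit"
  by (metis F2_add_add_cancel(2))

lemma F2_add_eq_0_iff [simp]: "x + y = 0 \<longleftrightarrow> x = y" for x y :: "nat \<Rightarrow> bit"
  by (simp add: F2_add_eq_iff)

lemma zero_in_F2 [simp]: "0 \<in> F2 n"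
  by (simp add: F2_def)

lemma add_in_F2 [intro, simp]: "x \<in> F2 n \<Longrightarrow> y \<in> F2 n \<Longrightarrow> x + y \<in> F2 n"
  by (simp add: F2_def)

lemma set_plus_subset_F2: "A \<subseteq> F2 n \<Longrightarrow> B \<subseteq> F2 n \<Longrightarrow> A + B \<subseteq> F2 n"
  by (auto elim!: set_plus_elim)

lemma bij_betw_support_F2: "bij_betw (\<lambda>x. {i. x i = 1}) (F2 n) (Pow {..<n})"
proof (rule bij_betwI [where g = "\<lambda>I i. if i \<in> I then 1 else 0"])
  show "(\<lambda>x. {i. x i = 1}) \<in> F2 n \<rightarrow> Pow {..<n}"
    by (auto simp: F2_def) (metis bit.distinct(1) linorder_not_less)
qed (auto simp: F2_def fun_eq_iff)

lemma finite_F2 [simp]: "finite (F2 n)"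
  using bij_betw_finite [OF bij_betw_support_F2] by simp

lemma card_F2: "card (F2 n) = 2 ^ n"
  using bij_betw_same_card [OF bij_betw_support_F2] by (simp add: card_Pow)

lemma finite_subset_F2: "A \<subseteq> F2 n \<Longrightarrow> finite A"
  by (rule finite_subset [OF _ finite_F2])

lemma dot_add_left: "dot n (x + y) v = dot n x v + dot n y v"
  by (simp only: dot_def plus_fun_apply distrib_right sum.distrib)

lemma dot_commute: "dot n x v = dot n v x"
  by (simp only: dot_def mult.commute)

lemma dot_0_left [simp]: "dot n 0 v = 0"
  by (simp add: dot_def)

lemma dot_0_right [simp]: "dot n v 0 = 0"
  by (simp add: dot_def)

lemma exists_dot_eq_1:
  assumes "v \<in> F2 n" "v \<noteq> 0"
  obtains w where "w \<in> F2 n" "dot n w v = 1"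
proof -
  obtain i where i: "v i \<noteq> 0" using assms(2) by (auto simp: fun_eq_iff)
  with assms(1) have "i < n" by (force simp: F2_def not_le [symmetric])
  define w where "w = (\<lambda>j. if j = i then 1 else (0::bit))"
  have "w \<in> F2 n" using \<open>i < n\<close> by (auto simp: w_def F2_def)
  moreover have "dot n w v = (\<Sum>j<n. if j = i then v j else 0)"
    unfolding dot_def w_def by (rule sum.cong) auto
  hence "dot n w v = 1" using \<open>i < n\<close> i by simp
  ultimately show ?thesis using that by blast
qed

text \<open>For nonzero \<open>v\<close>, the levels are the hyperplane \<open>perp n v\<close> and
  its other coset. A common notation is convenient because later arguments must handle either
  one.\<close>

definition level :: "nat \<Rightarrow> (nat \<Rightarrow> bit) \<Rightarrow> bit \<Rightarrow> (nat \<Rightarrow> bit) set" where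
  "level n v s = {x \<in> F2 n. dot n x v = s}"

lemma level_0: "level n v 0 = perp n v"
  by (simp add: level_def perp_def)

lemma level_subset: "level n v s \<subseteq> F2 n"
  by (auto simp: level_def)

lemma finite_level [simp]: "finite (level n v s)"
  using level_subset finite_subset_F2 by blast

lemma level_add: "x \<in> level n v s \<Longrightarrow> y \<in> level n v t \<Longrightarrow> x + y \<in> level n v (s + t)"
  by (auto simp: level_def dot_add_left)

lemma level_cases: "x \<in> F2 n \<Longrightarrow> x \<in> level n v s \<or> x \<in> level n v (s + 1)"
  by (cases s; cases "dot n x v") (auto simp: level_def)

lemma level_disjoint: "level n v s \<inter> level n v (s + 1) = {}"
  by (auto simp: level_def)

lemma level_Un: "level n v s \<union> level n v (s + 1) = F2 n"
  using level_cases level_subset by blast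

text \<open>Translation by a vector \<open>w\<close> with \<open>dot n w v = 1\<close> exchanges the
  two levels, so each is half of the space.\<close>

lemma card_level:
  assumes "v \<in> F2 n" "v \<noteq> 0"
  shows "2 * card (level n v s) = 2 ^ n"
proof -
  obtain w where w: "w \<in> F2 n" "dot n w v = 1" using exists_dot_eq_1 assms by blast
  have w1: "w \<in> level n v 1" using w by (simp add: level_def)
  have "bij_betw (\<lambda>x. x + w) (level n v s) (level n v (s + 1))"
    by (rule bij_betwI [where g = "\<lambda>x. x + w"])
      (use level_add [OF _ w1, of _ s] level_add [OF _ w1, of _ "s + 1"] in \<open>auto simp: add.assoc\<close>)
  hence "card (level n v s) = card (level n v (s + 1))" by (rule bij_betw_same_card)
  moreover have "card (level n v s) + card (level n v (s + 1)) = 2 ^ n"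
    by (subst card_Un_disjoint [symmetric]) (simp_all only: finite_level level_disjoint level_Un card_F2)
  ultimately show ?thesis by simp
qed

subsection \<open>Fourier analysis\<close>

definition chi :: "nat \<Rightarrow> (nat \<Rightarrow> bit) \<Rightarrow> (nat \<Rightarrow> bit) \<Rightarrow> real" where
  "chi n r x = (if dot n x r = 0 then 1 else -1)"

lemma chi_add: "chi n r (x + y) = chi n r x * chi n r y"
  by (auto simp: chi_def dot_add_left)

lemma chi_0_right [simp]: "chi n r 0 = 1"
  by (simp add: chi_def)

text \<open>Orthogonality of characters: for nonzero \<open>x\<close>, shifting \<open>r\<close> by
  some \<open>w\<close> with \<open>dot n w x = 1\<close> flips every sign, so the sum is its own
  negative.\<close>

lemma sum_chi:
  assumes "x \<in> F2 n"
  shows "(\<Sum>r\<in>F2 n. chi n r x) = (if x = 0 then 2 ^ n else 0)"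
proof (cases "x = 0")
  case False
  then obtain w where w: "w \<in> F2 n" "dot n w x = 1" using exists_dot_eq_1 assms by blast
  have "(\<Sum>r\<in>F2 n. chi n r x) = (\<Sum>r\<in>F2 n. chi n (r + w) x)"
    by (rule sum.reindex_bij_witness [of _ "\<lambda>r. r + w" "\<lambda>r. r + w"]) (use w in auto)
  also have "\<dots> = (\<Sum>r\<in>F2 n. - chi n r x)"
    using w by (intro sum.cong) (auto simp: chi_def dot_commute [of n x] dot_add_left)
  finally show ?thesis using False by (simp add: sum_negf)
qed (simp add: card_F2)

definition fourier :: "nat \<Rightarrow> (nat \<Rightarrow> bit) set \<Rightarrow> (nat \<Rightarrow> bit) \<Rightarrow> real" where
  "fourier n A r = (\<Sum>x\<in>A. chi n r x)"

text \<open>The edges spanned by \<open>A\<close> in the Cayley graph of \<open>D\<close>, as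
  ordered pairs: a pair of distinct vertices counts twice, and loops occur only if
  \<open>0 \<in> D\<close>.\<close>

definition edges :: "(nat \<Rightarrow> bit) set \<Rightarrow> (nat \<Rightarrow> bit) set \<Rightarrow> ((nat \<Rightarrow> bit) \<times> (nat \<Rightarrow> bit)) set" where
  "edges D A = {(a, b) \<in> A \<times> A. a + b \<in> D}"

lemma finite_edges: "finite A \<Longrightarrow> finite (edges D A)"
  by (rule finite_subset [of _ "A \<times> A"]) (auto simp: edges_def)

lemma fourier_0: "fourier n A 0 = card A"
  by (simp add: fourier_def chi_def)

text \<open>The character is 1 on \<open>perp n r\<close> and -1 off it. This turns intersections of
  \<open>D\<close> with hyperplanes into eigenvalues of its Cayley graph.\<close>

lemma fourier_eq_card:
  assumes "D \<subseteq> F2 n"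
  shows "fourier n D r = 2 * real (card (D \<inter> perp n r)) - real (card D)"
proof -
  have fin: "finite D" using assms finite_subset_F2 by blast
  have "fourier n D r = (\<Sum>x\<in>D. 2 * (if x \<in> D \<inter> perp n r then 1 else 0) - 1)"
    unfolding fourier_def by (rule sum.cong) (use assms in \<open>auto simp: chi_def perp_def\<close>)
  also have "\<dots> = 2 * real (card (D \<inter> perp n r)) - real (card D)"
    using fin by (simp add: sum_subtractf sum_distrib_left [symmetric] sum.If_cases)
  finally show ?thesis .
qed

text \<open>Parseval's identity: orthogonality keeps only the pairs with
  \<open>a = b\<close>.\<close>

lemma sum_fourier_square:
  assumes "A \<subseteq> F2 n"
  shows "(\<Sum>r\<in>F2 n. (fourier n A r)\<^sup>2) = 2 ^ n * real (card A)"
proof -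
  have fin: "finite A" using assms finite_subset_F2 by blast
  have "(\<Sum>r\<in>F2 n. (fourier n A r)\<^sup>2) = (\<Sum>r\<in>F2 n. \<Sum>a\<in>A. \<Sum>b\<in>A. chi n r (a + b))"
    by (simp add: fourier_def power2_eq_square sum_product chi_add)
  also have "\<dots> = (\<Sum>a\<in>A. \<Sum>b\<in>A. \<Sum>r\<in>F2 n. chi n r (a + b))"
    by (subst sum.swap, subst (2) sum.swap) simp
  also have "\<dots> = (\<Sum>a\<in>A. \<Sum>b\<in>A. if a = b then 2 ^ n else 0)"
    using assms by (intro sum.cong refl) (subst sum_chi, auto)
  finally show ?thesis using fin by simp
qed

text \<open>Orthogonality keeps exactly the triples with \<open>a + b = d\<close>, one for each
  edge.\<close>

lemma sum_fourier_edges: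
  assumes "A \<subseteq> F2 n" "D \<subseteq> F2 n"
  shows "(\<Sum>r\<in>F2 n. (fourier n A r)\<^sup>2 * fourier n D r) = 2 ^ n * real (card (edges D A))"
proof -
  have fin: "finite A" "finite D" using assms finite_subset_F2 by blast+
  have "(\<Sum>r\<in>F2 n. (fourier n A r)\<^sup>2 * fourier n D r)
      = (\<Sum>r\<in>F2 n. \<Sum>p\<in>A \<times> A. \<Sum>d\<in>D. chi n r (fst p + snd p + d))"
    by (simp add: fourier_def power2_eq_square sum_product chi_add sum.cartesian_product split_def)
  also have "\<dots> = (\<Sum>p\<in>A \<times> A. \<Sum>d\<in>D. \<Sum>r\<in>F2 n. chi n r (fst p + snd p + d))"
    by (subst sum.swap, subst (2) sum.swap) simp
  also have "\<dots> = (\<Sum>p\<in>A \<times> A. \<Sum>d\<in>D. if d = fst p + snd p then 2 ^ n else 0)"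
  proof (intro sum.cong refl)
    fix p d assume "p \<in> A \<times> A" "d \<in> D"
    hence "fst p + snd p + d \<in> F2 n" using assms by (intro add_in_F2) auto
    thus "(\<Sum>r\<in>F2 n. chi n r (fst p + snd p + d)) = (if d = fst p + snd p then 2 ^ n else 0)"
      by (subst sum_chi) auto
  qed
  also have "\<dots> = (\<Sum>p\<in>A \<times> A. if p \<in> edges D A then 2 ^ n else 0)"
    using fin by (intro sum.cong) (auto simp: edges_def)
  also have "\<dots> = 2 ^ n * real (card (edges D A))"
  proof -
    have "(A \<times> A) \<inter> edges D A = edges D A" by (auto simp: edges_def)
    thus ?thesis using fin by (simp add: sum.If_cases)
  qed
  finally show ?thesis .
qed

text \<open>The numbers \<open>fourier n D r\<close> are the eigenvalues of the Cayley graph of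
  \<open>D\<close>. The trivial one contributes the first summand; all others are at least
  \<open>2 * m - card D\<close>, and Parseval gives their total weight.\<close>

lemma hoffman_bound:
  fixes m :: real
  assumes "A \<subseteq> F2 n" "D \<subseteq> F2 n"
    and perp: "\<And>r. r \<in> F2 n \<Longrightarrow> r \<noteq> 0 \<Longrightarrow> m \<le> real (card (D \<inter> perp n r))"
  shows "(real (card A))\<^sup>2 * card D + (2 * m - card D) * (2 ^ n * real (card A) - (real (card A))\<^sup>2)
    \<le> 2 ^ n * real (card (edges D A))"
proof -
  have "(\<Sum>r\<in>F2 n - {0}. (fourier n A r)\<^sup>2 * (2 * m - card D))
      \<le> (\<Sum>r\<in>F2 n - {0}. (fourier n A r)\<^sup>2 * fourier n D r)"
    using perp by (intro sum_mono mult_left_mono) (auto simp: fourier_eq_card [OF assms(2)])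
  also have "\<dots> = 2 ^ n * real (card (edges D A)) - (real (card A))\<^sup>2 * card D"
    by (subst sum_diff1) (simp_all add: sum_fourier_edges assms fourier_0)
  also have "(\<Sum>r\<in>F2 n - {0}. (fourier n A r)\<^sup>2 * (2 * m - card D))
      = (2 * m - card D) * (\<Sum>r\<in>F2 n - {0}. (fourier n A r)\<^sup>2)"
    by (simp only: sum_distrib_left mult.commute)
  also have "(\<Sum>r\<in>F2 n - {0}. (fourier n A r)\<^sup>2) = 2 ^ n * real (card A) - (real (card A))\<^sup>2"
    by (subst sum_diff1) (simp_all add: sum_fourier_square assms fourier_0)
  finally show ?thesis by simp
qed

subsection \<open>Counting\<close>

lemma real_card_UN_le:
  fixes M :: real
  assumes "finite I" "\<And>i. i \<in> I \<Longrightarrow> real (card (G i)) \<le> M"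
  shows "real (card (\<Union>i\<in>I. G i)) \<le> real (card I) * M"
proof -
  have "card (\<Union>i\<in>I. G i) \<le> (\<Sum>i\<in>I. card (G i))" by (rule card_UN_le [OF assms(1)])
  hence "real (card (\<Union>i\<in>I. G i)) \<le> (\<Sum>i\<in>I. real (card (G i)))"
    by (metis of_nat_le_iff of_nat_sum)
  also have "\<dots> \<le> (\<Sum>i\<in>I. M)" by (intro sum_mono assms)
  finally show ?thesis by simp
qed

lemma card_image_Pow_le:
  fixes u :: real
  assumes "finite F" "real (card F) \<le> u"
  shows "real (card (f ` Pow F)) \<le> 2 powr u"
proof -
  have "real (card (f ` Pow F)) \<le> real (card (Pow F))" using assms by (intro of_nat_mono card_image_le) simp
  also have "\<dots> = 2 powr real (card F)" using assms by (simp add: card_Pow powr_realpow)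
  also have "\<dots> \<le> 2 powr u" using assms by (intro powr_mono) auto
  finally show ?thesis .
qed

lemma real_card_image_le:
  "finite X \<Longrightarrow> real (card (f ` X)) \<le> real (card X)"
  by (simp add: card_image_le)

text \<open>The involution splits \<open>R\<close> into pairs. Each pair rules out one of its
  \<open>k ^ 2\<close> colourings, a factor \<open>1 - 1 / k ^ 2\<close>, which becomes a square
  root when shared between the two elements. The induction removes one pair at a time.\<close>

lemma card_colourings_avoiding:
  fixes \<sigma> :: "'a \<Rightarrow> 'a" and i k :: nat
  assumes "finite V" "R \<subseteq> V" "i < k"
    and "\<And>a. a \<in> R \<Longrightarrow> \<sigma> a \<in> R" "\<And>a. a \<in> R \<Longrightarrow> \<sigma> a \<noteq> a" "\<And>a. a \<in> R \<Longrightarrow> \<sigma> (\<sigma> a) = a"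
  shows "real (card {c \<in> V \<rightarrow>\<^sub>E {..<k}. \<forall>a\<in>R. \<not> (c a = i \<and> c (\<sigma> a) = i)})
    \<le> real k ^ card V * sqrt (1 - 1 / real k ^ 2) ^ card R"
  using assms
proof (induction "card R" arbitrary: R V rule: less_induct)
  case less
  show ?case
  proof (cases "R = {}")
    case True
    thus ?thesis using less.prems by (simp add: card_PiE)
  next
    case False
    then obtain a where a: "a \<in> R" by blast
    define b where "b = \<sigma> a"
    have b: "b \<in> R" "b \<noteq> a" "\<sigma> b = a" using less.prems a by (auto simp: b_def)
    define W T where "W = V - {a, b}" and "T = R - {a, b}"
    have fin: "finite R" "finite W" using less.prems finite_subset by (auto simp: W_def)
    have abV: "{a, b} \<subseteq> V" using a b less.prems by auto
    have cards: "card V = card W + 2" "card R = card T + 2"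
      using card_Diff_subset [of "{a, b}" V] card_Diff_subset [of "{a, b}" R]
        card_mono [of V "{a, b}"] card_mono [of R "{a, b}"] abV a b less.prems fin
      by (auto simp: W_def T_def)
    define C where "C = {c \<in> V \<rightarrow>\<^sub>E {..<k}. \<forall>a\<in>R. \<not> (c a = i \<and> c (\<sigma> a) = i)}"
    define E where "E = {c \<in> W \<rightarrow>\<^sub>E {..<k}. \<forall>a\<in>T. \<not> (c a = i \<and> c (\<sigma> a) = i)}"
    have T\<sigma>: "\<sigma> x \<in> T" if "x \<in> T" for x
      using that less.prems(4,6) a b by (auto simp: T_def b_def) metis
    have IH: "real (card E) \<le> real k ^ card W * sqrt (1 - 1 / real k ^ 2) ^ card T"
      unfolding E_def by (rule less.hyps) (use less.prems cards T\<sigma> in \<open>auto simp: T_def W_def\<close>)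
    \<comment> \<open>A colouring is encoded by its colours on the removed pair, where
      \<open>(i, i)\<close> is excluded, and its restriction to the rest.\<close>
    define f where "f = (\<lambda>c::'a \<Rightarrow> nat. ((c a, c b), restrict c W))"
    have inj: "inj_on f C"
    proof (rule inj_onI)
      fix c d assume "c \<in> C" "d \<in> C" "f c = f d"
      hence cd: "c a = d a" "c b = d b" "restrict c W = restrict d W" "c \<in> V \<rightarrow>\<^sub>E {..<k}" "d \<in> V \<rightarrow>\<^sub>E {..<k}"
        by (auto simp: f_def C_def)
      have "c x = d x" if "x \<in> W" for x
        using cd(3) that by (metis restrict_apply')
      thus "c = d" using cd by (intro PiE_ext [OF cd(4,5)]) (auto simp: W_def)
    qed
    have img: "f ` C \<subseteq> ({..<k} \<times> {..<k} - {(i, i)}) \<times> E"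
    proof
      fix p assume "p \<in> f ` C"
      then obtain c where c: "c \<in> C" "p = f c" by blast
      have 1: "c \<in> V \<rightarrow>\<^sub>E {..<k}" "\<And>x. x \<in> R \<Longrightarrow> \<not> (c x = i \<and> c (\<sigma> x) = i)"
        using c by (auto simp: C_def)
      have "restrict c W \<in> W \<rightarrow>\<^sub>E {..<k}" using 1(1) by (auto simp: W_def PiE_iff)
      moreover have "T \<subseteq> W" using less.prems by (auto simp: T_def W_def)
      hence "\<not> (restrict c W x = i \<and> restrict c W (\<sigma> x) = i)" if "x \<in> T" for x
        using 1(2) [of x] that T\<sigma> [OF that] by (auto simp: T_def)
      ultimately have "restrict c W \<in> E" by (auto simp: E_def)
      moreover have "c a < k" "c b < k" using 1(1) abV by (auto simp: PiE_iff)
      ultimately show "p \<in> ({..<k} \<times> {..<k} - {(i, i)}) \<times> E"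
        using 1(2) [OF a] c(2) by (auto simp: f_def b_def)
    qed
    have "finite E" unfolding E_def using fin by (intro finite_subset [OF _ finite_PiE [of W "\<lambda>_. {..<k}"]]) auto
    hence "card C \<le> card (({..<k} \<times> {..<k} - {(i, i)}) \<times> E)"
      by (intro card_inj_on_le [OF inj img]) auto
    also have "\<dots> = (k\<^sup>2 - 1) * card E"
      using less.prems(3) by (simp add: card_cartesian_product card_Diff_singleton power2_eq_square)
    finally have "real (card C) \<le> real (k\<^sup>2 - 1) * real (card E)"
      by (metis of_nat_le_iff of_nat_mult)
    also have "\<dots> \<le> real (k\<^sup>2 - 1) * (real k ^ card W * sqrt (1 - 1 / real k ^ 2) ^ card T)"
      by (intro mult_left_mono IH) auto
    also have "real (k\<^sup>2 - 1) = real k ^ 2 * sqrt (1 - 1 / real k ^ 2) ^ 2"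
    proof -
      have k: "1 \<le> real k ^ 2" using less.prems(3) by simp
      hence "1 / real k ^ 2 \<le> 1" by (auto simp: divide_le_eq_1)
      hence "sqrt (1 - 1 / real k ^ 2) ^ 2 = 1 - 1 / real k ^ 2" by simp
      moreover have "real k \<noteq> 0" using less.prems(3) by simp
      ultimately show ?thesis using less.prems(3) by (simp add: of_nat_diff field_simps)
    qed
    also have "real k ^ 2 * sqrt (1 - 1 / real k ^ 2) ^ 2 * (real k ^ card W * sqrt (1 - 1 / real k ^ 2) ^ card T)
      = real k ^ card V * sqrt (1 - 1 / real k ^ 2) ^ card R"
      by (simp only: cards power_add) (simp only: mult_ac)
    finally show ?thesis by (simp add: C_def)
  qed
qed

text \<open>The case of two colours, with colour 1 meaning membership: each pair has three
  admissible patterns out of four.\<close>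

lemma card_subsets_avoiding:
  fixes \<sigma> :: "'a \<Rightarrow> 'a"
  assumes "finite V"
    and \<sigma>: "\<And>a. a \<in> V \<Longrightarrow> \<sigma> a \<in> V" "\<And>a. a \<in> V \<Longrightarrow> \<sigma> a \<noteq> a" "\<And>a. a \<in> V \<Longrightarrow> \<sigma> (\<sigma> a) = a"
  shows "real (card {P. P \<subseteq> V \<and> (\<forall>p\<in>P. \<sigma> p \<notin> P)}) \<le> sqrt 3 ^ card V"
proof -
  define C where "C = {c \<in> V \<rightarrow>\<^sub>E {..<2::nat}. \<forall>a\<in>V. \<not> (c a = 1 \<and> c (\<sigma> a) = 1)}"
  define f where "f = (\<lambda>P. \<lambda>x\<in>V. if x \<in> P then 1 else 0 :: nat)"
  have inj: "inj_on f {P. P \<subseteq> V \<and> (\<forall>p\<in>P. \<sigma> p \<notin> P)}"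
  proof (rule inj_onI)
    fix P Q assume "P \<in> {P. P \<subseteq> V \<and> (\<forall>p\<in>P. \<sigma> p \<notin> P)}" "Q \<in> {P. P \<subseteq> V \<and> (\<forall>p\<in>P. \<sigma> p \<notin> P)}"
      and eq: "f P = f Q"
    hence PQ: "P \<subseteq> V" "Q \<subseteq> V" by auto
    have "x \<in> P \<longleftrightarrow> x \<in> Q" if "x \<in> V" for x
      using fun_cong [OF eq, of x] that by (auto simp: f_def split: if_splits)
    thus "P = Q" using PQ by blast
  qed
  have val: "f P a = 1 \<longleftrightarrow> a \<in> P" if "P \<subseteq> V" "a \<in> V" for P a
    using that by (auto simp: f_def restrict_def)
  have img: "f ` {P. P \<subseteq> V \<and> (\<forall>p\<in>P. \<sigma> p \<notin> P)} \<subseteq> C"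
  proof safe
    fix P assume P: "P \<subseteq> V" "\<forall>p\<in>P. \<sigma> p \<notin> P"
    have "f P \<in> V \<rightarrow>\<^sub>E {..<2}" by (auto simp: f_def)
    thus "f P \<in> C" using val [OF P(1)] P(2) \<sigma>(1) by (auto simp: C_def)
  qed
  have "finite C" unfolding C_def
    using assms(1) by (intro finite_subset [OF _ finite_PiE [of V "\<lambda>_. {..<2}"]]) auto
  hence "real (card {P. P \<subseteq> V \<and> (\<forall>p\<in>P. \<sigma> p \<notin> P)}) \<le> real (card C)"
    using card_inj_on_le [OF inj img] by simp
  also have "\<dots> \<le> 2 ^ card V * sqrt (1 - 1 / 2 ^ 2) ^ card V"
    using card_colourings_avoiding [OF assms(1) order.refl, of 1 2 \<sigma>] \<sigma> by (simp add: C_def)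
  also have "\<dots> = (2 * sqrt (3 / 4)) ^ card V" by (simp add: power_mult_distrib)
  also have "2 * sqrt (3 / 4) = sqrt 3" by (simp add: real_sqrt_divide)
  finally show ?thesis .
qed

lemma sum_Pow_power_card:
  fixes y :: real
  assumes "finite V"
  shows "(\<Sum>X\<in>Pow V. y ^ card X) = (1 + y) ^ card V"
proof -
  have "(1 + y) ^ card V = (\<Prod>x\<in>V. 1 + y)" by simp
  also have "\<dots> = (\<Sum>X\<in>Pow V. y ^ card X)" using prod_add [OF assms, of "\<lambda>_. y" "\<lambda>_. 1"] by (simp add: add.commute)
  finally show ?thesis by simp
qed

definition small_subsets :: "real \<Rightarrow> 'a set \<Rightarrow> 'a set set" where
  "small_subsets \<delta> V = {X. X \<subseteq> V \<and> real (card X) \<le> \<delta> * real (card V)}"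

lemma finite_small_subsets: "finite V \<Longrightarrow> finite (small_subsets \<delta> V)"
  by (rule finite_subset [of _ "Pow V"]) (auto simp: small_subsets_def)

text \<open>Exponential weights replace entropy estimates: give \<open>X\<close> the weight
  \<open>y ^ card X\<close> with \<open>y < 1\<close>. All subsets together weigh
  \<open>(1 + y) ^ card V\<close>, while each small one weighs at least
  \<open>y powr (\<delta> * card V)\<close>.\<close>

lemma card_small_subsets:
  assumes "\<theta> > 0"
  obtains \<delta> where "\<delta> > 0"
    "\<And>V :: 'a set. finite V \<Longrightarrow> real (card (small_subsets \<delta> V)) \<le> 2 powr (\<theta> * real (card V))"
proof -
  \<comment> \<open>Half of \<open>\<theta>\<close> pays for the total weight through
    \<open>1 + y\<close>; the other half is spent by choosing \<open>\<delta>\<close> with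
    \<open>y powr \<delta> = 2 powr (- \<theta> / 2)\<close>.\<close>
  define y where "y = min (1/2) (2 powr (\<theta> / 2) - 1)"
  have y: "0 < y" "y < 1" "1 + y \<le> 2 powr (\<theta> / 2)"
  proof -
    have "2 powr (\<theta> / 2) > (2::real) powr 0" using assms by (intro powr_less_mono) auto
    thus "0 < y" "y < 1" "1 + y \<le> 2 powr (\<theta> / 2)" unfolding y_def by auto
  qed
  define \<delta> where "\<delta> = - (\<theta> / 2) / log 2 y"
  have log: "log 2 y < 0" using y by simp
  have \<delta>: "\<delta> > 0" unfolding \<delta>_def using assms log by (intro divide_neg_neg) auto
  have y\<delta>: "y powr (\<delta> * t) = 2 powr (- (\<theta> / 2) * t)" for t
  proof -
    have "y powr (\<delta> * t) = (2 powr log 2 y) powr (\<delta> * t)" using y by simp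
    also have "\<dots> = 2 powr (log 2 y * (\<delta> * t))" by (simp only: powr_powr)
    also have "log 2 y * (\<delta> * t) = - (\<theta> / 2) * t" using log by (simp add: \<delta>_def)
    finally show ?thesis .
  qed
  show ?thesis
  proof (rule that [OF \<delta>])
    fix V :: "'a set" assume V: "finite V"
    have "real (card (small_subsets \<delta> V)) * y powr (\<delta> * card V)
        = (\<Sum>X\<in>small_subsets \<delta> V. y powr (\<delta> * card V))" by simp
    also have "\<dots> \<le> (\<Sum>X\<in>small_subsets \<delta> V. y ^ card X)"
    proof (rule sum_mono)
      fix X assume "X \<in> small_subsets \<delta> V"
      hence "y powr (\<delta> * card V) \<le> y powr real (card X)"
        using y by (intro powr_mono') (auto simp: small_subsets_def)
      thus "y powr (\<delta> * card V) \<le> y ^ card X" using y by (simp add: powr_realpow)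
    qed
    also have "\<dots> \<le> (\<Sum>X\<in>Pow V. y ^ card X)"
      using V y by (intro sum_mono2) (auto simp: small_subsets_def)
    also have "\<dots> = (1 + y) ^ card V" by (rule sum_Pow_power_card [OF V])
    also have "\<dots> \<le> (2 powr (\<theta> / 2)) ^ card V" using y by (intro power_mono) auto
    also have "\<dots> = 2 powr (\<theta> / 2 * card V)"
      by (simp add: powr_realpow [symmetric] powr_powr)
    finally have "real (card (small_subsets \<delta> V)) * 2 powr (- (\<theta> / 2) * card V) \<le> 2 powr (\<theta> / 2 * card V)"
      by (simp only: y\<delta>)
    hence "real (card (small_subsets \<delta> V)) * 2 powr (- (\<theta> / 2) * card V) * 2 powr (\<theta> / 2 * card V)
        \<le> 2 powr (\<theta> / 2 * card V) * 2 powr (\<theta> / 2 * card V)"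
      by (rule mult_right_mono) simp
    thus "real (card (small_subsets \<delta> V)) \<le> 2 powr (\<theta> * real (card V))"
      by (simp only: mult.assoc powr_add [symmetric]) (simp add: field_simps)
  qed
qed

subsection \<open>Popular sums\<close>

text \<open>Its size is the number of ordered pairs in \<open>A \<times> A\<close> with sum
  \<open>x\<close>.\<close>

definition reps :: "(nat \<Rightarrow> bit) set \<Rightarrow> (nat \<Rightarrow> bit) \<Rightarrow> (nat \<Rightarrow> bit) set" where
  "reps A x = {a \<in> A. a + x \<in> A}"

text \<open>Edges are sorted by their sum \<open>x\<close>; those with sum \<open>x\<close>
  correspond to \<open>reps A x\<close>.\<close>

lemma card_edges_le:
  fixes M :: real
  assumes "finite A" "finite D" "\<And>x. x \<in> D \<Longrightarrow> real (card (reps A x)) \<le> M"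
  shows "real (card (edges D A)) \<le> real (card D) * M"
proof -
  have "bij_betw (\<lambda>(x, a). (a, a + x)) (SIGMA x:D. reps A x) (edges D A)"
    by (rule bij_betwI [where g = "\<lambda>(a, b). (a + b, a)"])
      (auto simp: edges_def reps_def add.commute [of _ "x + y" for x y])
  hence "card (edges D A) = (\<Sum>x\<in>D. card (reps A x))"
    using assms by (simp add: bij_betw_same_card [symmetric] card_SigmaI reps_def)
  hence "real (card (edges D A)) = (\<Sum>x\<in>D. real (card (reps A x)))" by simp
  also have "\<dots> \<le> (\<Sum>x\<in>D. M)" by (intro sum_mono assms)
  finally show ?thesis by simp
qed

text \<open>Averaging: the \<open>k\<close> classes partition \<open>A\<close>.\<close>

lemma exists_smallest_colour_class:
  fixes c :: "'a \<Rightarrow> nat"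
  assumes "finite A" "k > 0" "c ` A \<subseteq> {..<k}"
  obtains i where "i < k" "k * card {a \<in> A. c a = i} \<le> card A"
proof -
  have "\<exists>i<k. k * card {a \<in> A. c a = i} \<le> card A"
  proof (rule ccontr)
    assume "\<not> ?thesis"
    hence "\<And>i. i < k \<Longrightarrow> card A < k * card {a \<in> A. c a = i}" by (auto simp: not_le)
    hence "(\<Sum>i<k. card A) < (\<Sum>i<k. k * card {a \<in> A. c a = i})"
      using assms by (intro sum_strict_mono) auto
    also have "\<dots> = k * (\<Sum>i<k. \<Sum>a | a \<in> A \<and> c a = i. 1)" by (simp add: sum_distrib_left)
    also have "(\<Sum>i<k. \<Sum>a | a \<in> A \<and> c a = i. 1) = (\<Sum>a\<in>A. 1::nat)"
      by (rule sum.group) (use assms in auto)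
    finally show False by simp
  qed
  thus ?thesis using that by blast
qed

text \<open>A random colouring of \<open>A\<close> with \<open>k\<close> colours realises every popular sum within every
  colour class; the smallest class is the required sample.\<close>

lemma exists_sample:
  fixes \<eta> :: real
  assumes A: "A \<subseteq> F2 n" and k: "k \<ge> 2"
    and small: "2 ^ n * real k * sqrt (1 - 1 / real k ^ 2) powr (\<eta> * 2 ^ n) < 1"
  obtains A0 where "A0 \<subseteq> A" "k * card A0 \<le> card A"
    "\<And>x. x \<in> F2 n \<Longrightarrow> x \<noteq> 0 \<Longrightarrow> \<eta> * 2 ^ n \<le> real (card (reps A x)) \<Longrightarrow> x \<in> A0 + A0"
proof -
  define q where "q = sqrt (1 - 1 / real k ^ 2)"
  have "1 / real k ^ 2 < 1" using k by (simp add: divide_less_eq_1)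
  hence q: "0 < q" "q \<le> 1" unfolding q_def by auto
  have fin: "finite A" using A finite_subset_F2 by blast
  define X where "X = {x \<in> F2 n. x \<noteq> 0 \<and> \<eta> * 2 ^ n \<le> real (card (reps A x))}"
  have X: "finite X" "card X \<le> 2 ^ n"
    using card_mono [of "F2 n" X] by (auto simp: X_def card_F2)
  \<comment> \<open>The colourings whose class \<open>i\<close> fails to represent \<open>x\<close>.
    As \<open>x\<close> is nonzero, translation by \<open>x\<close> is an involution of
    \<open>reps A x\<close> without fixed points.\<close>
  define Bad where "Bad = (\<lambda>(x, i). {c \<in> A \<rightarrow>\<^sub>E {..<k}. \<forall>a\<in>reps A x. \<not> (c a = i \<and> c (a + x) = i)})"
  have bad: "real (card (Bad p)) \<le> real k ^ card A * q powr (\<eta> * 2 ^ n)" if p_in: "p \<in> X \<times> {..<k}" for p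
  proof -
    obtain x i where p: "p = (x, i)" "x \<in> X" "i < k" using p_in by auto
    have "real (card (Bad p)) \<le> real k ^ card A * q ^ card (reps A x)"
      unfolding p Bad_def split q_def
      by (rule card_colourings_avoiding)
        (use fin p in \<open>auto simp: reps_def X_def F2_add_eq_iff [of _ x]\<close>)
    also have "q ^ card (reps A x) = q powr real (card (reps A x))" using q by (simp add: powr_realpow)
    also have "real k ^ card A * \<dots> \<le> real k ^ card A * q powr (\<eta> * 2 ^ n)"
      using q p by (intro mult_left_mono powr_mono') (auto simp: X_def)
    finally show ?thesis .
  qed
  \<comment> \<open>Union bound over at most \<open>2 ^ n * k\<close> pairs; by
    \<open>small\<close>, the bad colourings do not exhaust all colourings.\<close>
  have "real (card (\<Union>p\<in>X \<times> {..<k}. Bad p)) \<le> (\<Sum>p\<in>X \<times> {..<k}. real (card (Bad p)))"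
    using card_UN_le [of "X \<times> {..<k}" Bad] X by (metis finite_SigmaI finite_lessThan of_nat_le_iff of_nat_sum)
  also have "\<dots> \<le> (\<Sum>p\<in>X \<times> {..<k}. real k ^ card A * q powr (\<eta> * 2 ^ n))"
    by (rule sum_mono) (rule bad)
  also have "\<dots> = real (card X) * real k * (real k ^ card A * q powr (\<eta> * 2 ^ n))"
    by (simp add: card_cartesian_product)
  also have "\<dots> \<le> 2 ^ n * real k * (real k ^ card A * q powr (\<eta> * 2 ^ n))"
    using X by (intro mult_right_mono) (auto simp flip: of_nat_le_iff)
  also have "\<dots> = real k ^ card A * (2 ^ n * real k * q powr (\<eta> * 2 ^ n))" by simp
  also have "\<dots> < real k ^ card A * 1"
    using small k unfolding q_def by (intro mult_strict_left_mono) auto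
  also have "\<dots> = real (card (A \<rightarrow>\<^sub>E {..<k}))" using fin by (simp add: card_PiE)
  finally have "card (\<Union>p\<in>X \<times> {..<k}. Bad p) < card (A \<rightarrow>\<^sub>E {..<k})" by simp
  moreover have "finite (\<Union>p\<in>X \<times> {..<k}. Bad p)"
    by (rule finite_subset [OF _ finite_PiE [OF fin, of "\<lambda>_. {..<k}"]]) (auto simp: Bad_def)
  ultimately have "\<not> (A \<rightarrow>\<^sub>E {..<k}) \<subseteq> (\<Union>p\<in>X \<times> {..<k}. Bad p)"
    using card_mono leD by blast
  then obtain c where c: "c \<in> A \<rightarrow>\<^sub>E {..<k}" "\<And>p. p \<in> X \<times> {..<k} \<Longrightarrow> c \<notin> Bad p" by blast
  obtain i where i: "i < k" "k * card {a \<in> A. c a = i} \<le> card A"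
    by (rule exists_smallest_colour_class [OF fin, of k c]) (use k c(1) in auto)
  show ?thesis
  proof (rule that [of "{a \<in> A. c a = i}"])
    fix x assume "x \<in> F2 n" "x \<noteq> 0" "\<eta> * 2 ^ n \<le> real (card (reps A x))"
    hence "(x, i) \<in> X \<times> {..<k}" using i by (auto simp: X_def)
    from c(2) [OF this] c(1) obtain a where a: "a \<in> reps A x" "c a = i" "c (a + x) = i"
      by (auto simp: Bad_def)
    hence "a + (a + x) \<in> {a \<in> A. c a = i} + {a \<in> A. c a = i}"
      by (intro set_plus_intro) (auto simp: reps_def)
    thus "x \<in> {a \<in> A. c a = i} + {a \<in> A. c a = i}" by simp
  qed (use i in auto)
qed

subsection \<open>Containers\<close>

text \<open>In the Cayley graph of \<open>D\<close>, a greedily chosen bounded set \<open>T \<subseteq> A\<close> determines a container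
  of almost all of \<open>A\<close>: each new element of \<open>T\<close> removes at least \<open>\<epsilon> 2\<^sup>n\<close> vertices.\<close>

definition unlinked :: "nat \<Rightarrow> (nat \<Rightarrow> bit) set \<Rightarrow> (nat \<Rightarrow> bit) set \<Rightarrow> (nat \<Rightarrow> bit) set" where
  "unlinked n D T = {y \<in> F2 n. \<forall>t\<in>T. t + y \<notin> D}"

text \<open>Determined by \<open>D\<close> and \<open>T\<close> alone, without reference to
  \<open>A\<close>; this is what makes it useful for counting.\<close>

definition container :: "nat \<Rightarrow> real \<Rightarrow> (nat \<Rightarrow> bit) set \<Rightarrow> (nat \<Rightarrow> bit) set \<Rightarrow> (nat \<Rightarrow> bit) set" where
  "container n \<epsilon> D T = {y \<in> unlinked n D T. real (card {z \<in> unlinked n D T. y + z \<in> D}) \<le> \<epsilon> * 2 ^ n}"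

lemma container_subset: "container n \<epsilon> D T \<subseteq> F2 n"
  unfolding container_def unlinked_def by blast

text \<open>Degrees are summed: every vertex of the container has few neighbours even in the larger
  set \<open>unlinked n D T\<close>.\<close>

lemma card_edges_container:
  assumes "\<epsilon> \<ge> 0"
  shows "real (card (edges D (container n \<epsilon> D T))) \<le> \<epsilon> * (2 ^ n)\<^sup>2"
proof -
  define F where "F = container n \<epsilon> D T"
  have F: "F \<subseteq> F2 n" by (simp add: F_def container_subset)
  hence "finite F" by (rule finite_subset_F2)
  have "edges D F = (SIGMA y:F. {z \<in> F. y + z \<in> D})" by (auto simp: edges_def)
  hence "real (card (edges D F)) = (\<Sum>y\<in>F. real (card {z \<in> F. y + z \<in> D}))"
    using \<open>finite F\<close> by (simp add: card_SigmaI)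
  also have "\<dots> \<le> (\<Sum>y\<in>F. \<epsilon> * 2 ^ n)"
  proof (rule sum_mono)
    fix y assume y: "y \<in> F"
    have "finite (unlinked n D T)" by (simp add: unlinked_def)
    hence "card {z \<in> F. y + z \<in> D} \<le> card {z \<in> unlinked n D T. y + z \<in> D}"
      by (intro card_mono) (auto simp: F_def container_def)
    moreover have "real (card {z \<in> unlinked n D T. y + z \<in> D}) \<le> \<epsilon> * 2 ^ n"
      using y by (auto simp: F_def container_def)
    ultimately show "real (card {z \<in> F. y + z \<in> D}) \<le> \<epsilon> * 2 ^ n" by linarith
  qed
  also have "\<dots> = real (card F) * (\<epsilon> * 2 ^ n)" by simp
  also have "\<dots> \<le> real (2 ^ n) * (\<epsilon> * 2 ^ n)"
    using F card_mono [of "F2 n" F] assms by (intro mult_right_mono) (auto simp: card_F2)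
  finally show ?thesis by (simp add: F_def power2_eq_square mult_ac)
qed

text \<open>\<open>T\<close> is a largest \<open>good\<close> set of vertices of low degree in
  \<open>A\<close>. The container misses only the vertices of high degree and the neighbours of
  \<open>T\<close>, at most \<open>1 + 1 / \<epsilon>\<close> portions of size
  \<open>\<zeta> * 2 ^ n\<close>.\<close>

lemma exists_container:
  fixes \<epsilon> \<zeta> :: real
  assumes A: "A \<subseteq> F2 n" and \<epsilon>: "\<epsilon> > 0" and \<zeta>: "\<zeta> > 0"
    and edges: "real (card (edges D A)) \<le> \<zeta>\<^sup>2 * (2 ^ n)\<^sup>2"
  obtains T where "T \<subseteq> A" "real (card T) \<le> 1 / \<epsilon>"
    "real (card (A - container n \<epsilon> D T)) \<le> (1 + 1 / \<epsilon>) * \<zeta> * 2 ^ n"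
proof -
  have fin: "finite A" using A finite_subset_F2 by blast
  define nb where "nb = (\<lambda>a. {b \<in> A. a + b \<in> D})"
  define A' where "A' = {a \<in> A. real (card (nb a)) \<le> \<zeta> * 2 ^ n}"
  have fin': "finite A'" "A' \<subseteq> A" using fin by (auto simp: A'_def)
  \<comment> \<open>Markov's inequality for the degrees in \<open>A\<close>.\<close>
  have removed: "real (card (A - A')) \<le> \<zeta> * 2 ^ n"
  proof -
    have "real (card (A - A')) * (\<zeta> * 2 ^ n) = (\<Sum>a\<in>A - A'. \<zeta> * 2 ^ n)" by simp
    also have "\<dots> \<le> (\<Sum>a\<in>A - A'. real (card (nb a)))"
      by (rule sum_mono) (auto simp: A'_def)
    also have "\<dots> \<le> (\<Sum>a\<in>A. real (card (nb a)))" using fin by (intro sum_mono2) auto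
    also have "\<dots> = real (card (SIGMA a:A. nb a))" using fin by (simp add: card_SigmaI nb_def)
    also have "(SIGMA a:A. nb a) = edges D A" by (auto simp: edges_def nb_def)
    finally have "real (card (A - A')) * (\<zeta> * 2 ^ n) \<le> (\<zeta> * 2 ^ n) * (\<zeta> * 2 ^ n)"
      using edges by (simp add: power2_eq_square mult_ac)
    thus ?thesis by (rule mult_right_le_imp_le) (use \<zeta> in simp)
  qed
  \<comment> \<open>Every element of \<open>T\<close> has to pay for
    \<open>\<epsilon> * 2 ^ n\<close> vertices, which bounds \<open>card T\<close> by
    \<open>1 / \<epsilon>\<close>.\<close>
  define good where
    "good = (\<lambda>T. T \<subseteq> A' \<and> real (card (unlinked n D T)) \<le> 2 ^ n - real (card T) * (\<epsilon> * 2 ^ n))"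
  have good0: "good {}" by (auto simp: good_def unlinked_def card_F2)
  have "\<forall>T. good T \<longrightarrow> card T < Suc (card A')"
    using fin'(1) by (simp add: good_def card_mono less_Suc_eq_le)
  from ex_has_greatest_nat [of good, OF good0 this]
  obtain T where T: "good T" "\<And>T'. good T' \<Longrightarrow> card T' \<le> card T" by blast
  have TA: "T \<subseteq> A'" "finite T" using T(1) finite_subset [OF _ fin'(1), of T] by (auto simp: good_def)
  have "real (card T) * (\<epsilon> * 2 ^ n) \<le> 1 * 2 ^ n"
    using T(1) of_nat_0_le_iff [of "card (unlinked n D T)"] unfolding good_def by linarith
  hence "real (card T) * \<epsilon> \<le> 1" by (simp add: mult.assoc [symmetric])
  hence cT: "real (card T) \<le> 1 / \<epsilon>" using \<epsilon> by (simp add: field_simps)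
  define U where "U = unlinked n D T"
  have finU: "finite U" by (simp add: U_def unlinked_def)
  \<comment> \<open>Maximality of \<open>T\<close>: a vertex \<open>y\<close> violating the bound
    could be inserted, since it removes enough vertices from \<open>U\<close>.\<close>
  have low: "real (card {z \<in> U. y + z \<in> D}) \<le> \<epsilon> * 2 ^ n" if y: "y \<in> A'" "y \<in> U" for y
  proof (rule ccontr)
    assume high: "\<not> ?thesis"
    have "y \<notin> T"
    proof
      assume "y \<in> T"
      hence empty: "{z \<in> U. y + z \<in> D} = {}" by (auto simp: U_def unlinked_def)
      show False using high \<epsilon> unfolding empty by simp
    qed
    have "unlinked n D (insert y T) = U - {z \<in> U. y + z \<in> D}" by (auto simp: U_def unlinked_def)
    moreover have "card (U - {z \<in> U. y + z \<in> D}) = card U - card {z \<in> U. y + z \<in> D}"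
      "card {z \<in> U. y + z \<in> D} \<le> card U"
      using finU by (auto intro!: card_Diff_subset card_mono)
    ultimately have "card (unlinked n D (insert y T)) + card {z \<in> U. y + z \<in> D} = card U" by simp
    hence "real (card (unlinked n D (insert y T))) + real (card {z \<in> U. y + z \<in> D}) = real (card U)"
      by (metis of_nat_add)
    moreover have "real (card U) \<le> 2 ^ n - real (card T) * (\<epsilon> * 2 ^ n)"
      using T(1) by (simp add: good_def U_def)
    ultimately have "good (insert y T)"
      using high TA y \<open>y \<notin> T\<close> by (auto simp: good_def algebra_simps)
    from T(2) [OF this] show False using \<open>y \<notin> T\<close> TA by simp
  qed
  \<comment> \<open>A vertex of \<open>A'\<close> in \<open>U\<close> lies in the container by
    \<open>low\<close>; a vertex of \<open>A\<close> outside \<open>U\<close> is adjacent to some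
    \<open>t\<close> in \<open>T\<close>.\<close>
  have "A - container n \<epsilon> D T \<subseteq> (A - A') \<union> (\<Union>t\<in>T. nb t)"
    using low A by (auto simp: container_def U_def unlinked_def nb_def)
  hence "card (A - container n \<epsilon> D T) \<le> card ((A - A') \<union> (\<Union>t\<in>T. nb t))"
    using fin TA by (intro card_mono) (auto simp: nb_def)
  also have "\<dots> \<le> card (A - A') + (\<Sum>t\<in>T. card (nb t))"
    using card_Un_le [of "A - A'" "\<Union>t\<in>T. nb t"] card_UN_le [of T nb] TA by linarith
  finally have "real (card (A - container n \<epsilon> D T)) \<le> real (card (A - A')) + (\<Sum>t\<in>T. real (card (nb t)))"
    by (simp flip: of_nat_sum of_nat_add)
  also have "\<dots> \<le> \<zeta> * 2 ^ n + (\<Sum>t\<in>T. \<zeta> * 2 ^ n)"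
    using TA by (intro add_mono removed sum_mono) (auto simp: A'_def)
  also have "\<dots> = \<zeta> * 2 ^ n + real (card T) * (\<zeta> * 2 ^ n)" by simp
  also have "\<dots> \<le> \<zeta> * 2 ^ n + 1 / \<epsilon> * (\<zeta> * 2 ^ n)"
    using cT \<zeta> by (intro add_mono mult_right_mono) auto
  finally have "real (card (A - container n \<epsilon> D T)) \<le> (1 + 1 / \<epsilon>) * \<zeta> * 2 ^ n"
    by (simp add: algebra_simps)
  thus ?thesis using that [of T] TA fin' cT by blast
qed

text \<open>In terms of the densities \<open>\<alpha>\<close> and \<open>d\<close>, and after
  division by \<open>N ^ 3\<close>, Hoffman's bound becomes the inequality \<open>key\<close>, which
  fails once \<open>\<alpha>\<close> exceeds \<open>1 / 2 - \<gamma> / 32\<close>.\<close>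

lemma card_le_of_few_edges:
  fixes \<gamma> :: real
  assumes F: "F \<subseteq> F2 n" and D: "D \<subseteq> F2 n"
    and \<gamma>: "0 < \<gamma>" "\<gamma> \<le> 1"
    and big: "2 ^ n / 4 \<le> real (card D)"
    and perp: "\<And>r. r \<in> F2 n \<Longrightarrow> r \<noteq> 0 \<Longrightarrow> \<gamma> * 2 ^ n \<le> real (card (D \<inter> perp n r))"
    and edges: "real (card (edges D F)) \<le> \<gamma> / 32 * (2 ^ n)\<^sup>2"
  shows "real (card F) \<le> (1 / 2 - \<gamma> / 32) * 2 ^ n"
proof (rule ccontr)
  assume neg: "\<not> ?thesis"
  define N where "N = (2::real) ^ n"
  have N: "N > 0" by (simp add: N_def)
  define \<alpha> d where "\<alpha> = real (card F) / N" and "d = real (card D) / N"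
  have eqs: "real (card F) = \<alpha> * N" "real (card D) = d * N" using N by (auto simp: \<alpha>_def d_def)
  have "real (card F) \<le> N" "real (card D) \<le> N"
    using card_mono [of "F2 n" F] card_mono [of "F2 n" D] F D by (auto simp: N_def card_F2 simp flip: of_nat_le_iff)
  hence le1: "\<alpha> \<le> 1" "d \<le> 1" using N by (auto simp: \<alpha>_def d_def)
  have d: "1 / 4 \<le> d" using big N unfolding eqs N_def [symmetric] by simp
  have \<alpha>: "1 / 2 - \<gamma> / 32 < \<alpha>" using neg N unfolding eqs N_def [symmetric] by simp
  have "(\<alpha> * N)\<^sup>2 * (d * N) + (2 * (\<gamma> * N) - d * N) * (N * (\<alpha> * N) - (\<alpha> * N)\<^sup>2)
      \<le> N * real (card (edges D F))"
    using hoffman_bound [OF F D perp] unfolding eqs N_def [symmetric] .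
  also have "\<dots> \<le> N * (\<gamma> / 32 * N\<^sup>2)"
    using edges N unfolding N_def [symmetric] by (intro mult_left_mono) auto
  finally have "N ^ 3 * (\<alpha> * d * (2 * \<alpha> - 1) + 2 * \<gamma> * \<alpha> * (1 - \<alpha>)) \<le> N ^ 3 * (\<gamma> / 32)"
    by (simp add: power2_eq_square power3_eq_cube) argo
  hence key: "\<alpha> * d * (2 * \<alpha> - 1) + 2 * \<gamma> * \<alpha> * (1 - \<alpha>) \<le> \<gamma> / 32"
    by (rule mult_left_le_imp_le) (use N in simp)
  show False
  \<comment> \<open>Up to density \<open>3 / 4\<close> the second summand of \<open>key\<close> is
    at least \<open>3 * \<gamma> / 8\<close> and the first at least \<open>- \<gamma> / 16\<close>.
    Beyond it, the first alone is at least \<open>3 / 32\<close>.\<close>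
  proof (cases "\<alpha> \<le> 3 / 4")
    case True
    have "\<alpha> * (1 - \<alpha>) \<ge> 3 / 16"
    proof -
      have "(\<alpha> - 1 / 4) * (3 / 4 - \<alpha>) \<ge> 0" using True \<alpha> \<gamma> by (intro mult_nonneg_nonneg) auto
      thus ?thesis by (simp add: field_simps)
    qed
    hence "2 * \<gamma> * (\<alpha> * (1 - \<alpha>)) \<ge> 2 * \<gamma> * (3 / 16)" using \<gamma> by (intro mult_left_mono) auto
    moreover have "\<alpha> * d * (2 * \<alpha> - 1) \<ge> - (\<gamma> / 16)"
    proof (cases "2 * \<alpha> - 1 \<ge> 0")
      case True
      hence "\<alpha> * d * (2 * \<alpha> - 1) \<ge> 0" using d \<alpha> \<gamma> by (intro mult_nonneg_nonneg) auto
      thus ?thesis using \<gamma> by linarith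
    next
      case False
      have "\<alpha> * d \<le> 1 * 1" using le1 d \<alpha> \<gamma> by (intro mult_mono) auto
      hence "\<alpha> * d * (1 - 2 * \<alpha>) \<le> 1 * (1 - 2 * \<alpha>)" using False by (intro mult_right_mono) auto
      thus ?thesis using \<alpha> by (simp add: algebra_simps)
    qed
    moreover have "2 * \<gamma> * \<alpha> * (1 - \<alpha>) = 2 * \<gamma> * (\<alpha> * (1 - \<alpha>))" by (simp only: mult.assoc)
    ultimately show False using key \<gamma> by linarith
  next
    case False
    have "3 / 4 * (1 / 4) * (1 / 2) \<le> \<alpha> * d * (2 * \<alpha> - 1)"
      using False d by (intro mult_mono mult_nonneg_nonneg) auto
    moreover have "0 \<le> 2 * \<gamma> * \<alpha> * (1 - \<alpha>)" using False \<gamma> le1 by (intro mult_nonneg_nonneg) auto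
    ultimately show False using key \<gamma> by simp
  qed
qed

subsection \<open>Sets close to a hyperplane\<close>

definition sum_avoiding :: "nat \<Rightarrow> (nat \<Rightarrow> bit) \<Rightarrow> (nat \<Rightarrow> bit) set set" where
  "sum_avoiding n v =
    {P. \<exists>s. \<exists>x\<in>perp n v - {0}. P \<subseteq> level n v s \<and> (\<forall>p\<in>P. p + x \<notin> P)}"

text \<open>Any \<open>x\<close> of the hyperplane missing from \<open>P + P\<close> is a witness;
  it is nonzero because \<open>p + p = 0\<close> for \<open>p\<close> in \<open>P\<close>.\<close>

lemma in_sum_avoiding:
  assumes P: "P \<subseteq> level n v s" and "P \<noteq> {}" and not: "\<not> perp n v \<subseteq> P + P"
  shows "P \<in> sum_avoiding n v"
proof -
  obtain x where x: "x \<in> perp n v" "x \<notin> P + P" using not by blast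
  have avoid: "p + x \<notin> P" if "p \<in> P" for p
  proof
    assume "p + x \<in> P"
    hence "p + (p + x) \<in> P + P" using that by (intro set_plus_intro)
    thus False using x by simp
  qed
  obtain p where "p \<in> P" using assms(2) by blast
  hence "x \<noteq> 0" using avoid [of p] by auto
  thus ?thesis using x P avoid unfolding sum_avoiding_def by blast
qed

lemma finite_sum_avoiding: "finite (sum_avoiding n v)"
proof (rule finite_subset)
  show "sum_avoiding n v \<subseteq> Pow (F2 n)" using level_subset unfolding sum_avoiding_def by blast
qed simp

text \<open>There are two levels and at most \<open>2 ^ n\<close> values of \<open>x\<close>.
  Translation by \<open>x\<close> pairs up the \<open>2 ^ n / 2\<close> points of the level, leaving
  three choices for each of the \<open>2 ^ n / 4\<close> pairs.\<close>

lemma card_sum_avoiding: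
  assumes v: "v \<in> F2 n" "v \<noteq> 0"
  shows "real (card (sum_avoiding n v)) \<le> 2 * 2 ^ n * 3 powr (2 ^ n / 4)"
proof -
  define I where "I = (UNIV :: bit set) \<times> (perp n v - {0})"
  define G where "G = (\<lambda>(s, x). {P. P \<subseteq> level n v s \<and> (\<forall>p\<in>P. p + x \<notin> P)})"
  have "perp n v \<subseteq> F2 n" by (auto simp: perp_def)
  hence fin: "finite (perp n v - {0})" "card (perp n v - {0}) \<le> 2 ^ n"
    using finite_subset_F2 [of "perp n v" n] card_mono [of "F2 n" "perp n v - {0}"] by (auto simp: card_F2)
  have UN: "(UNIV :: bit set) = {0, 1}" by (auto intro: bit.exhaust)
  have I: "finite I" "card I \<le> 2 * 2 ^ n"
    using fin by (auto simp: I_def UN card_cartesian_product)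
  have G: "real (card (G p)) \<le> 3 powr (2 ^ n / 4)" if p_in: "p \<in> I" for p
  proof -
    obtain s x where p: "p = (s, x)" "x \<in> perp n v" "x \<noteq> 0" using p_in by (auto simp: I_def)
    have "a + x \<in> level n v s" if "a \<in> level n v s" for a
      using level_add [OF that, of x 0] p(2) by (simp only: level_0 add_0_right)
    hence "real (card (G p)) \<le> sqrt 3 ^ card (level n v s)"
      unfolding p G_def split by (intro card_subsets_avoiding) (auto simp: p(3) F2_add_eq_iff [of _ x])
    also have "\<dots> = 3 powr (1 / 2 * real (card (level n v s)))"
      by (simp add: powr_half_sqrt [symmetric] powr_realpow [symmetric] powr_powr)
    also have "2 * real (card (level n v s)) = 2 ^ n"
      using card_level [OF v, of s] by (metis of_nat_mult of_nat_numeral of_nat_power)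
    hence "1 / 2 * real (card (level n v s)) = 2 ^ n / 4" by simp
    finally show ?thesis .
  qed
  have "sum_avoiding n v = (\<Union>p\<in>I. G p)" unfolding sum_avoiding_def I_def G_def by auto
  hence "card (sum_avoiding n v) \<le> (\<Sum>p\<in>I. card (G p))" using card_UN_le I by metis
  hence "real (card (sum_avoiding n v)) \<le> (\<Sum>p\<in>I. real (card (G p)))"
    by (metis of_nat_le_iff of_nat_sum)
  also have "\<dots> \<le> (\<Sum>p\<in>I. 3 powr (2 ^ n / 4))" by (rule sum_mono) (rule G)
  also have "\<dots> = real (card I) * 3 powr (2 ^ n / 4)" by simp
  also have "\<dots> \<le> real (2 * 2 ^ n) * 3 powr (2 ^ n / 4)"
    using I(2) by (intro mult_right_mono of_nat_mono) auto
  finally show ?thesis by simp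
qed

text \<open>\<open>D\<close> has density almost \<open>1 / 2\<close> and hardly meets the
  hyperplane, so it nearly fills the other coset. Almost all pairs between the two halves
  \<open>B\<close> and \<open>C\<close> of \<open>A\<close> are then edges, and few edges force one
  half to be small.\<close>

lemma near_hyperplane:
  fixes \<mu> \<epsilon> :: real
  assumes A: "A \<subseteq> F2 n" and D: "D \<subseteq> F2 n" and v: "v \<in> F2 n" "v \<noteq> 0" and "\<epsilon> \<ge> 0"
    and big: "(1 / 2 - \<mu>) * 2 ^ n \<le> real (card D)"
    and perp: "real (card (D \<inter> perp n v)) \<le> \<mu> * 2 ^ n"
    and edges: "real (card (edges D A)) \<le> \<mu> * (2 ^ n)\<^sup>2"
    and \<mu>: "3 * \<mu> \<le> \<epsilon>\<^sup>2"
  obtains s where "real (card (A - level n v s)) \<le> \<epsilon> * 2 ^ n"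
proof -
  have fin: "finite A" "finite D" using A D finite_subset_F2 by blast+
  define L where "L = level n v 1 - D"
  have "real (card L) \<le> 2 * \<mu> * 2 ^ n"
  proof -
    have "card (level n v 1) = card L + card (D \<inter> level n v 1)"
      unfolding L_def by (subst card_Un_disjoint [symmetric]) (auto intro!: arg_cong [of _ _ card])
    moreover have "card D = card (D \<inter> perp n v) + card (D \<inter> level n v 1)"
      using D fin by (subst card_Un_disjoint [symmetric])
        (auto intro!: arg_cong [of _ _ card] simp: perp_def level_def)
    moreover have "2 * real (card (level n v 1)) = 2 ^ n"
      using card_level [OF v, of 1] by (metis of_nat_mult of_nat_numeral of_nat_power)
    ultimately have "2 * real (card L) = 2 ^ n - 2 * real (card D) + 2 * real (card (D \<inter> perp n v))"
      by simp
    thus ?thesis using big perp by (simp add: algebra_simps)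
  qed
  moreover have "real (card (edges L A)) \<le> real (card L) * 2 ^ n"
  proof (rule card_edges_le)
    fix x
    have "card (reps A x) \<le> card (F2 n)" using A by (intro card_mono) (auto simp: reps_def)
    thus "real (card (reps A x)) \<le> 2 ^ n" by (simp add: card_F2 flip: of_nat_le_iff)
  qed (use fin in \<open>auto simp: L_def\<close>)
  ultimately have L: "real (card (edges L A)) \<le> 2 * \<mu> * (2 ^ n)\<^sup>2"
    by (smt (verit) mult.assoc mult_right_mono power2_eq_square zero_le_power)
  define B C where "B = A \<inter> level n v 0" and "C = A \<inter> level n v 1"
  have BC: "A - level n v 1 = B" "A - level n v 0 = C"
    using A level_cases [of _ n v 0] level_disjoint [of n v 0] by (auto simp: B_def C_def)
  \<comment> \<open>Sums across the two levels lie in \<open>level n v 1\<close>, hence in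
    \<open>D\<close> or in its missing part \<open>L\<close>.\<close>
  have "B \<times> C \<subseteq> edges D A \<union> edges L A"
    using level_add [of _ n v 0 _ 1] by (auto simp: B_def C_def edges_def L_def)
  hence "card (B \<times> C) \<le> card (edges D A \<union> edges L A)"
    using fin finite_edges by (intro card_mono) auto
  also have "\<dots> \<le> card (edges D A) + card (edges L A)" by (rule card_Un_le)
  finally have "card B * card C \<le> card (edges D A) + card (edges L A)"
    by (simp only: card_cartesian_product)
  hence "real (card B) * real (card C) \<le> real (card (edges D A)) + real (card (edges L A))"
    by (metis of_nat_add of_nat_le_iff of_nat_mult)
  also have "\<dots> \<le> 3 * \<mu> * (2 ^ n)\<^sup>2" using edges L by linarith
  also have "\<dots> \<le> \<epsilon>\<^sup>2 * (2 ^ n)\<^sup>2" using \<mu> by (intro mult_right_mono) auto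
  also have "\<dots> = (\<epsilon> * 2 ^ n) * (\<epsilon> * 2 ^ n)" by (simp add: power2_eq_square)
  finally have prod: "real (card B) * real (card C) \<le> (\<epsilon> * 2 ^ n) * (\<epsilon> * 2 ^ n)" .
  have "real (card B) \<le> \<epsilon> * 2 ^ n \<or> real (card C) \<le> \<epsilon> * 2 ^ n"
  proof (rule ccontr)
    assume "\<not> ?thesis"
    hence "(\<epsilon> * 2 ^ n) * (\<epsilon> * 2 ^ n) < real (card B) * real (card C)"
      using \<open>\<epsilon> \<ge> 0\<close> by (intro mult_strict_mono') auto
    thus False using prod by simp
  qed
  thus ?thesis using that BC by metis
qed

subsection \<open>Supersets of hyperplanes that are not sumsets\<close>

lemma perp_add_perp: "perp n v + perp n v = perp n v"
proof
  show "perp n v + perp n v \<subseteq> perp n v"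
    using level_add [of _ n v 0 _ 0] by (auto simp: level_0 elim!: set_plus_elim)
  have "0 + x \<in> perp n v + perp n v" if "x \<in> perp n v" for x
    by (rule set_plus_intro) (use that in \<open>auto simp: perp_def\<close>)
  thus "perp n v \<subseteq> perp n v + perp n v" by auto
qed

text \<open>The sums within \<open>{w} \<union> (P + w)\<close> are \<open>0\<close>, the elements
  of \<open>P\<close>, and the elements of \<open>P + P\<close>, which is the whole
  hyperplane.\<close>

lemma perp_superset_is_sumset:
  assumes v: "v \<in> F2 n" "v \<noteq> 0" and S: "S \<subseteq> F2 n" "perp n v \<subseteq> S"
    and all: "perp n v \<subseteq> (S - perp n v) + (S - perp n v)"
  shows "S \<in> sumset_family n"
proof -
  obtain w where w: "w \<in> F2 n" "dot n w v = 1" using exists_dot_eq_1 v by blast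
  define P where "P = S - perp n v"
  have P: "P \<subseteq> level n v 1" using S(1) by (auto simp: P_def perp_def level_def)
  define A' where "A' = insert w ((\<lambda>p. p + w) ` P)"
  have PF: "P \<subseteq> F2 n" using S by (auto simp: P_def)
  have A'F: "A' \<subseteq> F2 n" using w(1) PF by (auto simp: A'_def)
  have PP: "P + P \<subseteq> perp n v"
    using P level_add [of _ n v 1 _ 1] by (force simp: level_0 elim!: set_plus_elim)
  have shift: "(p + w) + (q + w) = p + q" for p q by (rule ext) simp
  have shift': "w + (p + w) = p" "(p + w) + w = p" for p by (rule ext, simp)+
  have "A' + A' = S"
  proof
    have "a + b \<in> S" if "a \<in> A'" "b \<in> A'" for a b
    proof -
      have "0 \<in> S" using S(2) by (auto simp: perp_def)
      moreover have "p \<in> S" if "p \<in> P" for p using that by (simp add: P_def)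
      moreover have "p + q \<in> S" if "p \<in> P" "q \<in> P" for p q
        using PP S(2) set_plus_intro [OF that] by blast
      ultimately show ?thesis using that by (auto simp: A'_def shift shift')
    qed
    thus "A' + A' \<subseteq> S" by (auto elim!: set_plus_elim)
    show "S \<subseteq> A' + A'"
    proof
      fix x assume "x \<in> S"
      show "x \<in> A' + A'"
      proof (cases "x \<in> P")
        case True
        hence "w + (x + w) \<in> A' + A'" by (intro set_plus_intro) (auto simp: A'_def)
        thus ?thesis by (simp only: shift')
      next
        case False
        hence "x \<in> P + P" using all \<open>x \<in> S\<close> by (auto simp: P_def)
        then obtain p q where pq: "p \<in> P" "q \<in> P" "x = p + q" by (auto elim!: set_plus_elim)
        hence "(p + w) + (q + w) \<in> A' + A'" by (intro set_plus_intro) (auto simp: A'_def)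
        thus ?thesis by (simp only: shift pq)
      qed
    qed
  qed
  thus ?thesis using A'F unfolding sumset_family_def by blast
qed

text \<open>\<open>P\<close> is nonempty because a hyperplane is a sumset of itself, and
  \<open>v\<close> is nonzero because otherwise \<open>perp n v\<close> is the whole space and
  \<open>P\<close> is empty.\<close>

lemma nonsumset_cases:
  assumes "S \<in> perp_superset_family n - sumset_family n"
  obtains v P where "v \<in> F2 n" "v \<noteq> 0" "P \<in> sum_avoiding n v" "S = perp n v \<union> P"
proof -
  obtain v where S: "S \<subseteq> F2 n" and v: "v \<in> F2 n" "perp n v \<subseteq> S" and not: "S \<notin> sumset_family n"
    using assms by (auto simp: perp_superset_family_def)
  define P where "P = S - perp n v"
  have SP: "S = perp n v \<union> P" using v by (auto simp: P_def)
  have perpF: "perp n v \<subseteq> F2 n" by (auto simp: perp_def)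
  have "P \<noteq> {}"
  proof
    assume "P = {}"
    hence "S = perp n v + perp n v" using SP by (simp add: perp_add_perp)
    thus False using not perpF by (auto simp: sumset_family_def)
  qed
  have v0: "v \<noteq> 0"
  proof
    assume "v = 0"
    hence "perp n v = F2 n" by (auto simp: perp_def)
    thus False using \<open>P \<noteq> {}\<close> S by (auto simp: P_def)
  qed
  have "\<not> perp n v \<subseteq> P + P" using perp_superset_is_sumset [OF v(1) v0 S v(2)] not by (auto simp: P_def)
  moreover have "P \<subseteq> level n v 1" using S by (auto simp: P_def perp_def level_def)
  ultimately have "P \<in> sum_avoiding n v" using \<open>P \<noteq> {}\<close> in_sum_avoiding by blast
  thus ?thesis using that v v0 SP by blast
qed

lemma card_nonsumsets:
  "real (card (perp_superset_family n - sumset_family n)) \<le> 2 * (2 ^ n)\<^sup>2 * 3 powr (2 ^ n / 4)"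
proof -
  define G where "G = (\<lambda>v. (\<lambda>P. perp n v \<union> P) ` sum_avoiding n v)"
  have "perp_superset_family n - sumset_family n \<subseteq> (\<Union>v\<in>F2 n - {0}. G v)"
    by (rule subsetI, erule nonsumset_cases) (auto simp: G_def)
  moreover have "finite (\<Union>v\<in>F2 n - {0}. G v)" by (simp add: G_def finite_sum_avoiding)
  ultimately have "real (card (perp_superset_family n - sumset_family n)) \<le> real (card (\<Union>v\<in>F2 n - {0}. G v))"
    by (intro of_nat_mono card_mono)
  also have "\<dots> \<le> real (card (F2 n - {0})) * (2 * 2 ^ n * 3 powr (2 ^ n / 4))"
  proof (rule real_card_UN_le)
    fix v assume v: "v \<in> F2 n - {0}"
    have "real (card (G v)) \<le> real (card (sum_avoiding n v))"
      unfolding G_def by (intro of_nat_mono card_image_le finite_sum_avoiding)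
    also have "\<dots> \<le> 2 * 2 ^ n * 3 powr (2 ^ n / 4)" using card_sum_avoiding v by blast
    finally show "real (card (G v)) \<le> 2 * 2 ^ n * 3 powr (2 ^ n / 4)" .
  qed simp
  also have "\<dots> \<le> 2 ^ n * (2 * 2 ^ n * 3 powr (2 ^ n / 4))"
    by (intro mult_right_mono) (auto simp: card_F2 card_Diff_subset of_nat_diff)
  finally show ?thesis by (simp add: power2_eq_square)
qed

subsection \<open>Sumsets containing no hyperplane\<close>

text \<open>\<open>0\<close> is removed separately: the sample \<open>B\<close> may be empty, and
  \<open>exists_sample\<close> controls only nonzero sums.\<close>

definition gap :: "nat \<Rightarrow> (nat \<Rightarrow> bit) set \<Rightarrow> (nat \<Rightarrow> bit) set" where
  "gap n B = F2 n - insert 0 (B + B)"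

lemma gap_subset: "gap n B \<subseteq> F2 n"
  by (auto simp: gap_def)

text \<open>With \<open>D = gap n B\<close> for a sample \<open>B\<close> of \<open>A\<close>, the
  alternatives are: \<open>D\<close> is sparse, \<open>D\<close> hardly meets some hyperplane, or
  neither. Each describes \<open>A + A\<close> or \<open>A\<close> by small sets and one member of a
  restricted family, so that it can be counted.\<close>

lemma sumset_trichotomy:
  fixes \<gamma> \<epsilon> \<delta> \<zeta> :: real
  assumes \<gamma>: "0 < \<gamma>" "\<gamma> \<le> 1 / 4" and \<epsilon>: "0 \<le> \<epsilon>" "3 * \<gamma> \<le> \<epsilon>\<^sup>2"
    and \<zeta>: "0 < \<zeta>" "\<zeta>\<^sup>2 \<le> \<gamma>" "(1 + 32 / \<gamma>) * \<zeta> \<le> \<delta>"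
    and n: "32 / \<gamma> \<le> \<delta> * 2 ^ n" and k: "k \<ge> 2" "1 / real k \<le> \<delta>"
    and sample: "2 ^ n * real k * sqrt (1 - 1 / real k ^ 2) powr (\<zeta>\<^sup>2 * 2 ^ n) < 1"
    and A: "A \<subseteq> F2 n" "A \<noteq> {}" "A + A \<notin> perp_superset_family n"
  shows "(\<exists>B\<in>small_subsets \<delta> (F2 n). real (card (gap n B)) \<le> (1 / 2 - \<gamma>) * 2 ^ n \<and> F2 n - (A + A) \<subseteq> gap n B)
    \<or> (\<exists>v\<in>F2 n - {0}. \<exists>P\<in>insert {} (sum_avoiding n v). \<exists>Q\<in>small_subsets \<epsilon> (F2 n). A = P \<union> Q)
    \<or> (\<exists>B\<in>small_subsets \<delta> (F2 n). \<exists>T\<in>small_subsets \<delta> (F2 n).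
        real (card (container n (\<gamma> / 32) (gap n B) T)) \<le> (1 / 2 - \<gamma> / 32) * 2 ^ n
        \<and> (\<exists>P\<in>Pow (container n (\<gamma> / 32) (gap n B) T). \<exists>Q\<in>small_subsets \<delta> (F2 n). A = P \<union> Q))"
proof -
  have fin: "finite A" using A(1) by (rule finite_subset_F2)
  have cA: "card A \<le> 2 ^ n" using card_mono [OF finite_F2 A(1)] by (simp add: card_F2)
  obtain B where B: "B \<subseteq> A" "k * card B \<le> card A"
    "\<And>x. x \<in> F2 n \<Longrightarrow> x \<noteq> 0 \<Longrightarrow> \<zeta>\<^sup>2 * 2 ^ n \<le> real (card (reps A x)) \<Longrightarrow> x \<in> B + B"
    using exists_sample [OF A(1) k(1) sample] by blast
  have Bsmall: "B \<in> small_subsets \<delta> (F2 n)"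
  proof -
    have "real k * real (card B) \<le> 2 ^ n"
      using order.trans [OF B(2) cA] by (metis of_nat_le_iff of_nat_mult of_nat_numeral of_nat_power)
    hence "real (card B) \<le> 1 / real k * 2 ^ n" using k by (simp add: field_simps)
    also have "\<dots> \<le> \<delta> * 2 ^ n" using k by (intro mult_right_mono) auto
    finally show ?thesis using A B by (auto simp: small_subsets_def card_F2)
  qed
  define D where "D = gap n B"
  have D: "D \<subseteq> F2 n" "finite D" using gap_subset finite_subset_F2 [OF gap_subset] by (auto simp: D_def)
  have cD: "real (card D) \<le> 2 ^ n"
    using card_mono [OF finite_F2 D(1)] by (simp add: card_F2 flip: of_nat_le_iff)
  \<comment> \<open>A nonzero sum missing from \<open>B + B\<close> is unpopular in
    \<open>A\<close>, so each \<open>x\<close> in \<open>D\<close> accounts for few edges.\<close>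
  have "real (card (edges D A)) \<le> real (card D) * (\<zeta>\<^sup>2 * 2 ^ n)"
    by (rule card_edges_le [OF fin D(2)]) (use B(3) in \<open>force simp: D_def gap_def\<close>)
  also have "\<dots> \<le> 2 ^ n * (\<zeta>\<^sup>2 * 2 ^ n)" using cD by (intro mult_right_mono) auto
  finally have edges: "real (card (edges D A)) \<le> \<zeta>\<^sup>2 * (2 ^ n)\<^sup>2"
    by (simp add: power2_eq_square mult_ac)
  show ?thesis
  proof (cases "real (card D) \<le> (1 / 2 - \<gamma>) * 2 ^ n")
    case True
    obtain a where "a \<in> A" using A(2) by blast
    hence "a + a \<in> A + A" by (intro set_plus_intro)
    hence "0 \<in> A + A" by simp
    moreover have "B + B \<subseteq> A + A" using B(1) by (intro set_plus_mono2)
    ultimately have "F2 n - (A + A) \<subseteq> D" by (auto simp: D_def gap_def)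
    thus ?thesis using True Bsmall unfolding D_def by (intro disjI1 bexI [of _ B] conjI)
  next
    case big: False
    show ?thesis
    proof (cases "\<exists>v\<in>F2 n - {0}. real (card (D \<inter> perp n v)) \<le> \<gamma> * 2 ^ n")
      case True
      then obtain v where v: "v \<in> F2 n" "v \<noteq> 0" "real (card (D \<inter> perp n v)) \<le> \<gamma> * 2 ^ n" by blast
      have "real (card (edges D A)) \<le> \<gamma> * (2 ^ n)\<^sup>2"
        by (rule order.trans [OF edges mult_right_mono]) (use \<zeta> in auto)
      then obtain s where s: "real (card (A - level n v s)) \<le> \<epsilon> * 2 ^ n"
        using near_hyperplane [OF A(1) D(1) v(1,2) \<epsilon>(1) _ v(3) _ \<epsilon>(2)] big by auto
      define P where "P = A \<inter> level n v s"
      \<comment> \<open>If \<open>P + P\<close> contained the hyperplane, so would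
        \<open>A + A\<close>.\<close>
      have "P \<in> insert {} (sum_avoiding n v)"
      proof (cases "P = {}")
        case False
        have "perp n v \<subseteq> P + P \<Longrightarrow> perp n v \<subseteq> A + A"
          using set_plus_mono2 [of P A P A] by (auto simp: P_def)
        hence "\<not> perp n v \<subseteq> P + P"
          using A(3) v set_plus_subset_F2 [OF A(1) A(1)] by (auto simp: perp_superset_family_def)
        thus ?thesis using in_sum_avoiding [of P n v s] False by (auto simp: P_def)
      qed simp
      moreover have "A - level n v s \<in> small_subsets \<epsilon> (F2 n)"
        using s A(1) by (auto simp: small_subsets_def card_F2)
      moreover have "A = P \<union> (A - level n v s)" by (auto simp: P_def)
      ultimately have "\<exists>P\<in>insert {} (sum_avoiding n v). \<exists>Q\<in>small_subsets \<epsilon> (F2 n). A = P \<union> Q" by blast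
      moreover have "v \<in> F2 n - {0}" using v by simp
      ultimately show ?thesis by (intro disjI2 disjI1 bexI [of _ v])
    next
      case False
      hence perp: "\<gamma> * 2 ^ n \<le> real (card (D \<inter> perp n r))" if "r \<in> F2 n" "r \<noteq> 0" for r
        using that by force
      \<comment> \<open>The degree threshold \<open>\<gamma> / 32\<close> is the edge density that
        \<open>card_le_of_few_edges\<close> tolerates; it caps \<open>card T\<close> at
        \<open>32 / \<gamma>\<close>.\<close>
      have \<gamma>32: "\<gamma> / 32 > 0" "1 / (\<gamma> / 32) = 32 / \<gamma>" using \<gamma> by auto
      obtain T where T: "T \<subseteq> A" "real (card T) \<le> 32 / \<gamma>"
        "real (card (A - container n (\<gamma> / 32) D T)) \<le> (1 + 32 / \<gamma>) * \<zeta> * 2 ^ n"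
        using exists_container [OF A(1) \<gamma>32(1) \<zeta>(1) edges] unfolding \<gamma>32(2) by blast
      define F where "F = container n (\<gamma> / 32) D T"
      have "real (card F) \<le> (1 / 2 - \<gamma> / 32) * 2 ^ n"
      proof (rule card_le_of_few_edges [OF _ D(1)])
        show "F \<subseteq> F2 n" by (simp add: F_def container_subset)
        have "1 / 4 * 2 ^ n \<le> (1 / 2 - \<gamma>) * 2 ^ n" using \<gamma> by (intro mult_right_mono) auto
        thus "2 ^ n / 4 \<le> real (card D)" using big by linarith
        show "real (card (edges D F)) \<le> \<gamma> / 32 * (2 ^ n)\<^sup>2"
          unfolding F_def by (rule card_edges_container) (use \<gamma> in simp)
      qed (use \<gamma> perp in auto)
      moreover have "T \<in> small_subsets \<delta> (F2 n)"
        using T(1,2) A(1) n by (auto simp: small_subsets_def card_F2)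
      moreover have "A - F \<in> small_subsets \<delta> (F2 n)"
      proof -
        have "(1 + 32 / \<gamma>) * \<zeta> * 2 ^ n \<le> \<delta> * 2 ^ n" using \<zeta>(3) by (intro mult_right_mono) auto
        hence "real (card (A - F)) \<le> \<delta> * 2 ^ n" using T(3) unfolding F_def by linarith
        thus ?thesis using A(1) by (auto simp: small_subsets_def card_F2)
      qed
      moreover have "A = (A \<inter> F) \<union> (A - F)" "A \<inter> F \<in> Pow F" by auto
      ultimately have "real (card F) \<le> (1 / 2 - \<gamma> / 32) * 2 ^ n
          \<and> (\<exists>P\<in>Pow F. \<exists>Q\<in>small_subsets \<delta> (F2 n). A = P \<union> Q)"
        and Tsmall: "T \<in> small_subsets \<delta> (F2 n)" by blast+
      from this(1) show ?thesis
        unfolding F_def D_def by (intro disjI2 bexI [of _ B] bexI [of _ T] Tsmall Bsmall)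
    qed
  qed
qed

text \<open>Counts the three alternatives of \<open>sumset_trichotomy\<close>; the summand 1 is for
  the empty sumset, and the first and third alternatives share the second summand.\<close>

lemma card_sumsets_without_perp:
  obtains \<kappa> :: real where "\<kappa> > 0"
    "\<forall>\<^sub>F n in sequentially. real (card (sumset_family n - perp_superset_family n))
      \<le> 1 + 2 * 2 powr ((1 / 2 - \<kappa>) * 2 ^ n)
        + 2 ^ n * ((1 + 2 * 2 ^ n * 3 powr (2 ^ n / 4)) * 2 powr (1 / 20 * 2 ^ n))"
proof -
  \<comment> \<open>Parameters are fixed in the order \<open>\<epsilon>\<close>,
    \<open>\<gamma>\<close>, \<open>\<delta>\<close>, \<open>\<zeta>\<close>, \<open>k\<close>. The
    value \<open>1 / 20\<close> works because \<open>3 powr (1 / 4) \<le> 2 powr (2 / 5)\<close> and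
    \<open>2 / 5 + 1 / 20 < 1 / 2\<close>.\<close>
  obtain \<epsilon> :: real where \<epsilon>: "\<epsilon> > 0"
    "\<And>V :: (nat \<Rightarrow> bit) set. finite V \<Longrightarrow> real (card (small_subsets \<epsilon> V)) \<le> 2 powr (1 / 20 * real (card V))"
    using card_small_subsets [of "1 / 20"] by auto
  define \<gamma> where "\<gamma> = min (1 / 4) (\<epsilon>\<^sup>2 / 3)"
  have \<gamma>: "0 < \<gamma>" "\<gamma> \<le> 1 / 4" "3 * \<gamma> \<le> \<epsilon>\<^sup>2" using \<epsilon>(1) by (auto simp: \<gamma>_def)
  \<comment> \<open>The third alternative chooses three small sets, costing
    \<open>3 * \<theta>\<close>, and gains \<open>\<gamma> / 32 = 4 * \<theta>\<close>; one
    \<open>\<theta>\<close> is left over.\<close>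
  define \<theta> where "\<theta> = \<gamma> / 128"
  have \<theta>: "\<theta> > 0" using \<gamma> by (simp add: \<theta>_def)
  obtain \<delta> :: real where \<delta>: "\<delta> > 0"
    "\<And>V :: (nat \<Rightarrow> bit) set. finite V \<Longrightarrow> real (card (small_subsets \<delta> V)) \<le> 2 powr (\<theta> * real (card V))"
    using card_small_subsets [OF \<theta>] by blast
  \<comment> \<open>The first bound makes the edge count small enough for
    \<open>near_hyperplane\<close>, the second keeps the part of \<open>A\<close> outside the
    container small.\<close>
  define \<zeta> where "\<zeta> = min (sqrt \<gamma>) (\<delta> / (1 + 32 / \<gamma>))"
  have pos: "1 + 32 / \<gamma> > 0" using \<gamma> by (simp add: add_pos_pos)
  have \<zeta>: "0 < \<zeta>" "\<zeta>\<^sup>2 \<le> \<gamma>" "(1 + 32 / \<gamma>) * \<zeta> \<le> \<delta>"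
  proof -
    show "0 < \<zeta>" using \<gamma> \<delta> pos by (simp add: \<zeta>_def)
    hence "\<zeta>\<^sup>2 \<le> (sqrt \<gamma>)\<^sup>2" by (intro power_mono) (auto simp: \<zeta>_def)
    thus "\<zeta>\<^sup>2 \<le> \<gamma>" using \<gamma> by simp
    have "(1 + 32 / \<gamma>) * \<zeta> \<le> (1 + 32 / \<gamma>) * (\<delta> / (1 + 32 / \<gamma>))"
      using pos by (intro mult_left_mono) (auto simp: \<zeta>_def)
    thus "(1 + 32 / \<gamma>) * \<zeta> \<le> \<delta>" using pos by simp
  qed
  obtain k0 :: nat where k0: "1 / \<delta> < real k0" using reals_Archimedean2 by blast
  define k where "k = max 2 k0"
  have k: "k \<ge> 2" "1 / real k \<le> \<delta>"
  proof -
    show "k \<ge> 2" by (simp add: k_def)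
    have "1 / \<delta> < real k" using k0 by (simp add: k_def)
    thus "1 / real k \<le> \<delta>" using \<delta>(1) \<open>k \<ge> 2\<close> by (simp add: field_simps)
  qed
  define q where "q = sqrt (1 - 1 / real k ^ 2)"
  have q: "0 < q" "q < 1"
  proof -
    have "1 / real k ^ 2 < 1" using k by (simp add: divide_less_eq_1)
    moreover have "1 / real k ^ 2 > 0" using k by simp
    ultimately show "0 < q" "q < 1" unfolding q_def by auto
  qed
  define b where "b = - (\<zeta>\<^sup>2 * ln q)"
  have b: "b > 0" using q \<zeta> by (simp add: b_def mult_pos_neg)
  have q_powr: "q powr (\<zeta>\<^sup>2 * x) = exp (- (b * x))" for x using q by (simp add: powr_def b_def mult_ac)
  have two: "filterlim (\<lambda>n. (2::real) ^ n) at_top sequentially" by real_asymp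
  have ev1: "\<forall>\<^sub>F n in sequentially. 32 / \<gamma> \<le> \<delta> * 2 ^ n"
  proof -
    have "filterlim (\<lambda>n. \<delta> * 2 ^ n) at_top sequentially" using \<delta>(1) by real_asymp
    thus ?thesis by (auto simp: filterlim_at_top)
  qed
  have ev2: "\<forall>\<^sub>F n in sequentially. 2 ^ n * real k * q powr (\<zeta>\<^sup>2 * 2 ^ n) < 1"
  proof -
    \<comment> \<open>In terms of \<open>x = 2 ^ n\<close>, exponential decay beats the linear
      factor.\<close>
    have lim: "((\<lambda>x. x * real k * exp (- (b * x))) \<longlongrightarrow> 0) at_top" using b by real_asymp
    have "((\<lambda>n. 2 ^ n * real k * exp (- (b * 2 ^ n))) \<longlongrightarrow> 0) sequentially"
      using filterlim_compose [OF lim two] by simp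
    hence "\<forall>\<^sub>F n in sequentially. 2 ^ n * real k * exp (- (b * 2 ^ n)) < 1"
      by (rule order_tendstoD) simp
    thus ?thesis by (simp only: q_powr)
  qed
  have "\<forall>\<^sub>F n in sequentially. real (card (sumset_family n - perp_superset_family n))
      \<le> 1 + 2 * 2 powr ((1 / 2 - \<gamma> / 128) * 2 ^ n)
        + 2 ^ n * ((1 + 2 * 2 ^ n * 3 powr (2 ^ n / 4)) * 2 powr (1 / 20 * 2 ^ n))"
    using ev1 ev2
  proof eventually_elim
    case (elim n)
    define V where "V = F2 n"
    have V: "finite V" "card V = 2 ^ n" by (simp_all add: V_def card_F2)
    define dbl where "dbl = (\<lambda>A. A + A :: (nat \<Rightarrow> bit) set)"
    define I1 where "I1 = {B \<in> small_subsets \<delta> V. real (card (gap n B)) \<le> (1 / 2 - \<gamma>) * 2 ^ n}"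
    \<comment> \<open>Here the sumsets themselves are recovered, from their complements inside the
      gap; \<open>C2\<close> and \<open>C3\<close> recover \<open>A\<close> instead.\<close>
    define C1 where "C1 = (\<Union>B\<in>I1. (\<lambda>Z. V - Z) ` Pow (gap n B))"
    define C2 where "C2 = (\<Union>v\<in>V - {0}.
      (\<lambda>(P, Q). dbl (P \<union> Q)) ` (insert {} (sum_avoiding n v) \<times> small_subsets \<epsilon> V))"
    define cont where "cont = (\<lambda>(B, T). container n (\<gamma> / 32) (gap n B) T)"
    define I3 where "I3 = {p \<in> small_subsets \<delta> V \<times> small_subsets \<delta> V.
      real (card (cont p)) \<le> (1 / 2 - \<gamma> / 32) * 2 ^ n}"
    define C3 where "C3 = (\<Union>(p, Q)\<in>I3 \<times> small_subsets \<delta> V. (\<lambda>P. dbl (P \<union> Q)) ` Pow (cont p))"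
    have fin_small: "finite (small_subsets \<eta> V)" for \<eta> using V(1) by (rule finite_small_subsets)
    have fin_gap: "finite (gap n B)" for B by (rule finite_subset_F2 [OF gap_subset])
    have fin_cont: "finite (cont p)" for p
      by (cases p) (simp add: cont_def finite_subset_F2 [OF container_subset])
    have I1: "finite I1" "card I1 \<le> card (small_subsets \<delta> V)"
      unfolding I1_def using fin_small [of \<delta>] by (auto intro!: card_mono)
    have "I3 \<subseteq> small_subsets \<delta> V \<times> small_subsets \<delta> V" by (auto simp: I3_def)
    moreover have "finite (small_subsets \<delta> V \<times> small_subsets \<delta> V)" using fin_small [of \<delta>] by simp
    ultimately have I3: "finite I3" "card I3 \<le> card (small_subsets \<delta> V \<times> small_subsets \<delta> V)"
      using finite_subset card_mono by blast+
    have small: "real (card (small_subsets \<delta> V)) \<le> 2 powr (\<theta> * 2 ^ n)"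
      "real (card (small_subsets \<epsilon> V)) \<le> 2 powr (1 / 20 * 2 ^ n)"
      using \<delta>(2) [OF V(1)] \<epsilon>(2) [OF V(1)] by (simp_all add: V(2))
    have "real (card C1) \<le> real (card I1) * 2 powr ((1 / 2 - \<gamma>) * 2 ^ n)"
      unfolding C1_def by (intro real_card_UN_le I1 card_image_Pow_le fin_gap) (simp add: I1_def)
    also have "\<dots> \<le> 2 powr (\<theta> * 2 ^ n) * 2 powr ((1 / 2 - \<gamma>) * 2 ^ n)"
      using I1(2) small(1) by (intro mult_right_mono) auto
    also have "\<dots> \<le> 2 powr ((1 / 2 - \<gamma> / 128) * 2 ^ n)"
      unfolding powr_add [symmetric] distrib_right [symmetric] \<theta>_def
      using \<gamma> by (intro powr_mono mult_right_mono) auto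
    finally have C1: "real (card C1) \<le> 2 powr ((1 / 2 - \<gamma> / 128) * 2 ^ n)" .
    have "real (card C2) \<le> real (card (V - {0})) * ((1 + 2 * 2 ^ n * 3 powr (2 ^ n / 4)) * 2 powr (1 / 20 * 2 ^ n))"
      unfolding C2_def
    proof (rule real_card_UN_le)
      fix v assume v: "v \<in> V - {0}"
      define X where "X = insert {} (sum_avoiding n v) \<times> small_subsets \<epsilon> V"
      have "finite X" by (simp add: X_def finite_sum_avoiding fin_small)
      hence "real (card ((\<lambda>(P, Q). dbl (P \<union> Q)) ` X)) \<le> real (card X)" by (rule real_card_image_le)
      also have "\<dots> = real (card (insert {} (sum_avoiding n v))) * real (card (small_subsets \<epsilon> V))"
        by (simp add: X_def card_cartesian_product)
      also have "\<dots> \<le> (1 + 2 * 2 ^ n * 3 powr (2 ^ n / 4)) * 2 powr (1 / 20 * 2 ^ n)"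
      proof (intro mult_mono small)
        have "card (insert {} (sum_avoiding n v)) \<le> 1 + card (sum_avoiding n v)"
          by (simp add: card_insert_if finite_sum_avoiding)
        hence "real (card (insert {} (sum_avoiding n v))) \<le> 1 + real (card (sum_avoiding n v))" by linarith
        also have "\<dots> \<le> 1 + 2 * 2 ^ n * 3 powr (2 ^ n / 4)"
          using card_sum_avoiding [of v n] v by (simp add: V_def)
        finally show "real (card (insert {} (sum_avoiding n v))) \<le> 1 + 2 * 2 ^ n * 3 powr (2 ^ n / 4)" .
      qed auto
      finally show "real (card ((\<lambda>(P, Q). dbl (P \<union> Q)) ` (insert {} (sum_avoiding n v) \<times> small_subsets \<epsilon> V)))
        \<le> (1 + 2 * 2 ^ n * 3 powr (2 ^ n / 4)) * 2 powr (1 / 20 * 2 ^ n)" by (simp only: X_def)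
    qed (simp add: V)
    also have "\<dots> \<le> 2 ^ n * ((1 + 2 * 2 ^ n * 3 powr (2 ^ n / 4)) * 2 powr (1 / 20 * 2 ^ n))"
    proof (rule mult_right_mono)
      have "card (V - {0}) \<le> card V" using V(1) by (intro card_mono) auto
      thus "real (card (V - {0})) \<le> 2 ^ n" by (simp add: V(2) flip: of_nat_le_iff)
    qed auto
    finally have C2: "real (card C2) \<le> 2 ^ n * ((1 + 2 * 2 ^ n * 3 powr (2 ^ n / 4)) * 2 powr (1 / 20 * 2 ^ n))" .
    have "real (card C3) \<le> real (card (I3 \<times> small_subsets \<delta> V)) * 2 powr ((1 / 2 - \<gamma> / 32) * 2 ^ n)"
      unfolding C3_def
    proof (rule real_card_UN_le)
      fix i assume "i \<in> I3 \<times> small_subsets \<delta> V"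
      then obtain p Q where i: "i = (p, Q)" "p \<in> I3" by auto
      show "real (card (case i of (p, Q) \<Rightarrow> (\<lambda>P. dbl (P \<union> Q)) ` Pow (cont p))) \<le> 2 powr ((1 / 2 - \<gamma> / 32) * 2 ^ n)"
        unfolding i split using i(2) by (intro card_image_Pow_le fin_cont) (simp add: I3_def)
    qed (use I3 fin_small in blast)
    also have "\<dots> \<le> (2 powr (\<theta> * 2 ^ n) * 2 powr (\<theta> * 2 ^ n) * 2 powr (\<theta> * 2 ^ n)) * 2 powr ((1 / 2 - \<gamma> / 32) * 2 ^ n)"
    proof (rule mult_right_mono)
      have "real (card (I3 \<times> small_subsets \<delta> V)) \<le> real (card ((small_subsets \<delta> V \<times> small_subsets \<delta> V) \<times> small_subsets \<delta> V))"
        using I3(2) by (simp only: card_cartesian_product of_nat_le_iff mult_le_mono1)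
      also have "\<dots> = real (card (small_subsets \<delta> V)) * real (card (small_subsets \<delta> V)) * real (card (small_subsets \<delta> V))"
        by (simp add: card_cartesian_product)
      also have "\<dots> \<le> 2 powr (\<theta> * 2 ^ n) * 2 powr (\<theta> * 2 ^ n) * 2 powr (\<theta> * 2 ^ n)"
        by (intro mult_mono small) auto
      finally show "real (card (I3 \<times> small_subsets \<delta> V)) \<le> 2 powr (\<theta> * 2 ^ n) * 2 powr (\<theta> * 2 ^ n) * 2 powr (\<theta> * 2 ^ n)" .
    qed simp
    also have "\<dots> = 2 powr ((1 / 2 - \<gamma> / 128) * 2 ^ n)"
      unfolding powr_add [symmetric] distrib_right [symmetric] \<theta>_def by simp
    finally have C3: "real (card C3) \<le> 2 powr ((1 / 2 - \<gamma> / 128) * 2 ^ n)" .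
    have "sumset_family n - perp_superset_family n \<subseteq> {{}} \<union> C1 \<union> C2 \<union> C3"
    proof
      fix S assume S: "S \<in> sumset_family n - perp_superset_family n"
      then obtain A where A: "A \<subseteq> F2 n" "S = A + A" "A + A \<notin> perp_superset_family n"
        by (auto simp: sumset_family_def)
      show "S \<in> {{}} \<union> C1 \<union> C2 \<union> C3"
      proof (cases "A = {}")
        case True
        hence "S = {}" using A(2) by (auto elim!: set_plus_elim)
        thus ?thesis by simp
      next
        case False
        have SV: "S \<subseteq> V" using A set_plus_subset_F2 by (simp add: V_def)
        from sumset_trichotomy [OF \<gamma>(1,2) less_imp_le [OF \<epsilon>(1)] \<gamma>(3) \<zeta> elim(1) k elim(2) [unfolded q_def] A(1) False A(3)]
        show ?thesis
        proof (elim disjE bexE conjE, goal_cases)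
          case (1 B)
          have "B \<in> I1" using 1 by (simp add: I1_def V_def)
          moreover have "V - S \<in> Pow (gap n B)" using 1 by (simp add: A(2) V_def)
          moreover have "S = V - (V - S)" using SV by blast
          ultimately have "S \<in> C1" unfolding C1_def by blast
          thus ?case by simp
        next
          case (2 v P Q)
          have "(P, Q) \<in> insert {} (sum_avoiding n v) \<times> small_subsets \<epsilon> V" using 2 by (simp add: V_def)
          moreover have "S = (\<lambda>(P, Q). dbl (P \<union> Q)) (P, Q)" using A(2) 2 by (simp add: dbl_def)
          ultimately have "S \<in> (\<lambda>(P, Q). dbl (P \<union> Q)) ` (insert {} (sum_avoiding n v) \<times> small_subsets \<epsilon> V)"
            by (rule rev_image_eqI)
          moreover have "v \<in> V - {0}" using 2 by (simp add: V_def)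
          ultimately have "S \<in> C2" unfolding C2_def by (rule UN_I [rotated])
          thus ?case by simp
        next
          case (3 B T P Q)
          have "((B, T), Q) \<in> I3 \<times> small_subsets \<delta> V" using 3 by (simp add: I3_def V_def cont_def)
          moreover have "S \<in> (\<lambda>P. dbl (P \<union> Q)) ` Pow (cont (B, T))"
            by (rule rev_image_eqI [of P]) (use 3 A(2) in \<open>simp_all add: cont_def dbl_def\<close>)
          ultimately have "S \<in> C3" unfolding C3_def by (intro UN_I [of "((B, T), Q)"]) simp_all
          thus ?case by simp
        qed
      qed
    qed
    moreover have "finite C1" unfolding C1_def by (simp add: I1(1) fin_gap)
    moreover have "finite C2" unfolding C2_def by (simp add: V(1) finite_sum_avoiding fin_small)
    moreover have "finite C3" unfolding C3_def by (simp add: I3(1) fin_cont fin_small split_def)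
    ultimately have "card (sumset_family n - perp_superset_family n) \<le> card ({{}} \<union> C1 \<union> C2 \<union> C3)"
      by (intro card_mono) auto
    also have "\<dots> \<le> 1 + card C1 + card C2 + card C3"
      using card_Un_le [of "{{}} \<union> C1 \<union> C2" C3] card_Un_le [of "{{}} \<union> C1" C2] card_Un_le [of "{{}}" C1] by simp
    finally have "real (card (sumset_family n - perp_superset_family n))
        \<le> 1 + real (card C1) + real (card C2) + real (card C3)" by linarith
    thus ?case using C1 C2 C3 by linarith
  qed
  thus ?thesis using that [of "\<gamma> / 128"] \<gamma> by simp
qed

section \<open>Lower bound for the main term and asymptotic comparison\<close>

text \<open>One hyperplane suffices, that of vectors with first coordinate 0: adjoining different
  subsets of its complement gives different sets.\<close>

lemma card_perp_superset_family_ge: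
  assumes "n \<ge> 1"
  shows "2 powr (2 ^ n / 2) \<le> real (card (perp_superset_family n))"
proof -
  define v :: "nat \<Rightarrow> bit" where "v = (\<lambda>i. if i = 0 then 1 else 0)"
  have v: "v \<in> F2 n" "v \<noteq> 0" using assms by (auto simp: v_def F2_def fun_eq_iff)
  have "2 * real (card (level n v 1)) = 2 ^ n"
    using card_level [OF v, of 1] by (metis of_nat_mult of_nat_numeral of_nat_power)
  hence half: "2 ^ n / 2 = real (card (level n v 1))" by simp
  have "2 powr (2 ^ n / 2) = real (card (Pow (level n v 1)))" unfolding half by (simp add: card_Pow powr_realpow)
  also have "\<dots> \<le> real (card (perp_superset_family n))"
  proof (intro of_nat_mono card_inj_on_le)
    have disj: "perp n v \<inter> level n v 1 = {}" using level_disjoint [of n v 0] by (simp add: level_0)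
    show "inj_on (\<lambda>P. perp n v \<union> P) (Pow (level n v 1))" using disj by (intro inj_onI) blast
    show "(\<lambda>P. perp n v \<union> P) ` Pow (level n v 1) \<subseteq> perp_superset_family n"
      using v(1) level_subset [of n v 1] level_subset [of n v 0] by (auto simp: perp_superset_family_def level_0)
    show "finite (perp_superset_family n)"
      by (rule finite_subset [of _ "Pow (F2 n)"]) (auto simp: perp_superset_family_def)
  qed
  finally show ?thesis .
qed

text \<open>This is \<open>3 ^ 5 = 243 \<le> 256 = 2 ^ 8\<close>.\<close>

lemma three_powr_le: "3 powr (x / 4) \<le> 2 powr (2 / 5 * x)" if "x \<ge> 0" for x :: real
proof -
  have "(3::real) powr (x / 4) = (3 powr 5) powr (x / 20)" by (simp only: powr_powr) simp
  also have "\<dots> = (3 ^ 5) powr (x / 20)" by simp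
  also have "\<dots> \<le> (2 ^ 8) powr (x / 20)" using that by (intro powr_mono2) auto
  also have "\<dots> = (2 powr 8) powr (x / 20)" by simp
  also have "\<dots> = 2 powr (2 / 5 * x)" by (simp only: powr_powr) simp
  finally show ?thesis .
qed

theorem theorem1p2:
  shows "(\<lambda>n. real (card (sym_diff (sumset_family n) (perp_superset_family n))))
           \<in> o(\<lambda>n. real (card (sumset_family n)))"
proof -
  define S H where "S = sumset_family" and "H = perp_superset_family"
  have fin: "finite (S n)" "finite (H n)" for n
  proof -
    show "finite (S n)"
      by (rule finite_subset [of _ "Pow (F2 n)"])
        (auto simp: S_def sumset_family_def dest: set_plus_subset_F2 [THEN subsetD, rotated 2])
    show "finite (H n)"
      by (rule finite_subset [of _ "Pow (F2 n)"]) (auto simp: H_def perp_superset_family_def)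
  qed
  obtain \<kappa> :: real where \<kappa>: "\<kappa> > 0" and ev: "\<forall>\<^sub>F n in sequentially. real (card (S n - H n))
      \<le> 1 + 2 * 2 powr ((1 / 2 - \<kappa>) * 2 ^ n)
        + 2 ^ n * ((1 + 2 * 2 ^ n * 3 powr (2 ^ n / 4)) * 2 powr (1 / 20 * 2 ^ n))"
    using card_sumsets_without_perp unfolding S_def H_def by blast
  \<comment> \<open>A bound for both differences together as a function of \<open>x = 2 ^ n\<close>,
    with powers of 3 replaced by means of \<open>three_powr_le\<close>; the last summand is for
    supersets of hyperplanes that are not sumsets.\<close>
  define g where "g = (\<lambda>x::real. 1 + 2 * 2 powr ((1 / 2 - \<kappa>) * x)
    + x * ((1 + 2 * x * 2 powr (2 / 5 * x)) * 2 powr (1 / 20 * x)) + 2 * x\<^sup>2 * 2 powr (2 / 5 * x))"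
  have "g x / 2 powr (x / 2) = 2 powr (- (x / 2)) + 2 * 2 powr (- (\<kappa> * x)) + x * 2 powr (- (9 / 20 * x))
      + 2 * x\<^sup>2 * 2 powr (- (1 / 20 * x)) + 2 * x\<^sup>2 * 2 powr (- (1 / 10 * x))" for x
  proof -
    have "2 powr (- (x / 2)) = 1 / 2 powr (x / 2)" by (simp add: powr_minus_divide)
    moreover have "2 powr (- (\<kappa> * x)) = 2 powr ((1 / 2 - \<kappa>) * x) / 2 powr (x / 2)"
      unfolding powr_diff [symmetric] by (simp add: algebra_simps)
    moreover have "2 powr (- (9 / 20 * x)) = 2 powr (1 / 20 * x) / 2 powr (x / 2)"
      unfolding powr_diff [symmetric] by (simp add: algebra_simps)
    moreover have "2 powr (- (1 / 20 * x)) = 2 powr (2 / 5 * x) * 2 powr (1 / 20 * x) / 2 powr (x / 2)"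
      unfolding powr_diff [symmetric] powr_add [symmetric] by (simp add: algebra_simps)
    moreover have "2 powr (- (1 / 10 * x)) = 2 powr (2 / 5 * x) / 2 powr (x / 2)"
      unfolding powr_diff [symmetric] by (simp add: algebra_simps)
    ultimately show ?thesis
      by (simp only: g_def) (simp add: add_divide_distrib distrib_left distrib_right power2_eq_square mult_ac)
  qed
  moreover have "((\<lambda>x. 2 powr (- (x / 2)) + 2 * 2 powr (- (\<kappa> * x)) + x * 2 powr (- (9 / 20 * x))
      + 2 * x\<^sup>2 * 2 powr (- (1 / 20 * x)) + 2 * x\<^sup>2 * 2 powr (- (1 / 10 * x))) \<longlongrightarrow> 0) at_top"
  proof -
    have l1: "((\<lambda>x. 2 * (2::real) powr (- (\<kappa> * x))) \<longlongrightarrow> 0) at_top" using \<kappa> by real_asymp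
    have l2: "((\<lambda>x::real. 2 powr (- (x / 2))) \<longlongrightarrow> 0) at_top" by real_asymp
    have l3: "((\<lambda>x::real. x * 2 powr (- (9 / 20 * x)) + 2 * x\<^sup>2 * 2 powr (- (1 / 20 * x))
      + 2 * x\<^sup>2 * 2 powr (- (1 / 10 * x))) \<longlongrightarrow> 0) at_top" by real_asymp
    show ?thesis using tendsto_add [OF tendsto_add [OF l2 l1] l3] by (simp only: add.assoc add_0_right)
  qed
  ultimately have "((\<lambda>x. g x / 2 powr (x / 2)) \<longlongrightarrow> 0) at_top" by simp
  moreover have "filterlim (\<lambda>n. (2::real) ^ n) at_top sequentially" by real_asymp
  ultimately have lim: "((\<lambda>n. g (2 ^ n) / 2 powr (2 ^ n / 2)) \<longlongrightarrow> 0) sequentially"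
    by (rule filterlim_compose)
  show ?thesis
  proof (rule landau_o.smallI)
    fix c :: real assume c: "c > 0"
    \<comment> \<open>The bound \<open>1 / 2\<close> ensures that the sumsets number at least
      \<open>u / 2\<close>, and \<open>c / 2\<close> then compares the difference with that
      half.\<close>
    have "\<forall>\<^sub>F n in sequentially. g (2 ^ n) / 2 powr (2 ^ n / 2) < min (1 / 2) (c / 2)"
      using lim by (rule order_tendstoD) (use c in auto)
    thus "\<forall>\<^sub>F n in sequentially. norm (real (card (sym_diff (sumset_family n) (perp_superset_family n))))
        \<le> c * norm (real (card (sumset_family n)))"
      using ev eventually_ge_at_top [of 1]
    proof eventually_elim
      case (elim n)
      define N where "N = (2::real) ^ n"
      define u where "u = 2 powr (N / 2)"
      define d where "d = real (card (sym_diff (S n) (H n)))"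
      have "N \<ge> 0" "u > 0" by (simp_all add: N_def u_def)
      have "d \<le> real (card (S n - H n)) + real (card (H n - S n))"
        unfolding d_def using card_Un_le [of "S n - H n" "H n - S n"] by linarith
      also have "\<dots> \<le> (1 + 2 * 2 powr ((1 / 2 - \<kappa>) * N) + N * ((1 + 2 * N * 3 powr (N / 4)) * 2 powr (1 / 20 * N)))
          + 2 * N\<^sup>2 * 3 powr (N / 4)"
        using elim(2) card_nonsumsets [of n] unfolding N_def S_def H_def by (rule add_mono)
      also have "\<dots> \<le> g N"
        unfolding g_def using three_powr_le [OF \<open>N \<ge> 0\<close>] \<open>N \<ge> 0\<close>
        by (intro add_mono mult_left_mono mult_right_mono order.refl) auto
      also have "g N / u < min (1 / 2) (c / 2)" using elim(1) by (simp only: N_def u_def)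
      hence "g N < min (1 / 2) (c / 2) * u" using \<open>u > 0\<close> by (simp only: pos_divide_less_eq)
      finally have d: "d < min (1 / 2) (c / 2) * u" .
      have "min (1 / 2) (c / 2) * u \<le> 1 / 2 * u" "min (1 / 2) (c / 2) * u \<le> c / 2 * u"
        using \<open>u > 0\<close> by (intro mult_right_mono; simp)+
      hence du: "d \<le> u / 2" "d \<le> c * (u / 2)" using d by simp_all
      \<comment> \<open>The lower bound \<open>u\<close> is known for \<open>H n\<close> only; it
        passes to \<open>S n\<close> with a loss of at most \<open>d \<le> u / 2\<close>.\<close>
      have "card (H n) \<le> card (S n \<union> sym_diff (S n) (H n))" using fin by (intro card_mono) auto
      also have "\<dots> \<le> card (S n) + card (sym_diff (S n) (H n))" by (rule card_Un_le)
      finally have "real (card (H n)) \<le> real (card (S n)) + d" unfolding d_def by linarith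
      moreover have "u \<le> real (card (H n))"
        using card_perp_superset_family_ge [OF elim(3)] by (simp add: u_def N_def H_def)
      ultimately have "u / 2 \<le> real (card (S n))" using du by linarith
      hence "c * (u / 2) \<le> c * real (card (S n))" using c by (intro mult_left_mono) auto
      hence "d \<le> c * real (card (S n))" using du by linarith
      thus ?case by (simp add: d_def S_def H_def)
    qed
  qed
qed

end
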